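(* Let $T\in(0,\infty]$ and $\gamma\in(0,1)$. Let $\varphi\in X$. If the distributional derivative of $\varphi$ on $(0,T)$ is integrable on $(0,T_1)$ for any $T_1\in(0,T)$, then there is a version of $\varphi$ (still denoted $\varphi$; i.e. a function equal to $\varphi$ up to a Lebesgue null set) that is absolutely continuous on $(0,T_1)$ for any $T_1<T$, so that $$D_c^\gamma\varphi(t)=\frac{1}{\Gamma(1-\gamma)}\int_0^t\frac{\varphi'(s)}{(t-s)^\gamma}\,ds,\qquad t<T,$$ where the convolution integral can be understood in the Lebesgue sense. Further, $D_c^\gamma\varphi\in L^1_{\mathrm{loc}}[0,T)$.
   Context: $L^1_{\mathrm{loc}}[0,T)$ is the set of functions integrable on every compact subset of $[0,T)$; such functions are identified with distributions in $\mathscr D'(-\infty,T)$ by extension by zero to $t<0$. $\theta$ is the Heaviside function and $g_\alpha(t)=\theta(t)t^{\alpha-1}/\Gamma(\alpha)$ for $\alpha>0$. $X$ is the set of $\varphi\in L^1_{\mathrm{loc}}[0,T)$ for which there is a (unique) $\varphi_0\in\mathbb{R}$ with $\lim_{t\to0^+}\frac1t\int_0^t|\varphi-\varphi_0|\,ds=0$; one writes $\varphi(0+):=\varphi_0$. For $\varphi\in X$, the Caputo derivative of order $\gamma\in(0,1)$ is the distribution $D_c^\gamma\varphi:=J_{-\gamma}\varphi-\varphi(0+)g_{1-\gamma}\in\mathscr D'(-\infty,T)$, where $J_{-\gamma}\varphi=g_{-\gamma}*(\theta\varphi)$ with $g_{-\gamma}=\frac{1}{\Gamma(1-\gamma)}D(\theta(t)t^{-\gamma})$,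 i.e. $J_{-\gamma}\varphi$ is the distributional derivative on $(-\infty,T)$ of the locally integrable function equal to $\frac{1}{\Gamma(1-\gamma)}\int_0^t(t-s)^{-\gamma}\varphi(s)\,ds$ for $0<t<T$ and $0$ for $t<0$. *)

theory Defs
  imports "HOL-Analysis.Analysis"
begin

text \<open>
  Functions given only up to null sets are represented by functions on the whole real line; values
  outside the relevant interval are irrelevant. The endpoint \<open>T \<in> (0,\<infinity>]\<close> is an extended real.
\<close>

definition L1loc :: "ereal \<Rightarrow> (real \<Rightarrow> real) set" where
  "L1loc T = {f. \<forall>K. compact K \<and> K \<subseteq> {t. 0 \<le> t \<and> ereal t < T} \<longrightarrow> set_integrable lebesgue K f}"

definition test_fun :: "real set \<Rightarrow> (real \<Rightarrow> real) set" where
  "test_fun U = {\<eta>. (\<forall>n x. ((deriv ^^ n) \<eta>) differentiable (at x)) \<and>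
     compact (closure {x. \<eta> x \<noteq> 0}) \<and> closure {x. \<eta> x \<noteq> 0} \<subseteq> U}"

text \<open>
  Distributions on an open set \<open>U\<close> are represented by functionals, of which only the values on
  \<open>test_fun U\<close> matter. All the functionals below arise from locally integrable functions by
  differentiation and linear combination, so that they are linear and continuous there.
\<close>

type_synonym distr = "(real \<Rightarrow> real) \<Rightarrow> real"

definition distr_eq :: "real set \<Rightarrow> distr \<Rightarrow> distr \<Rightarrow> bool" where
  "distr_eq U u v \<longleftrightarrow> (\<forall>\<eta>\<in>test_fun U. u \<eta> = v \<eta>)"

definition reg_distr :: "real set \<Rightarrow> (real \<Rightarrow> real) \<Rightarrow> distr" where
  "reg_distr U f = (\<lambda>\<eta>. LINT t:U|lebesgue. f t * \<eta> t)"

definition distr_deriv :: "distr \<Rightarrow> distr" where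
  "distr_deriv u = (\<lambda>\<eta>. - u (deriv \<eta>))"

text \<open>The restriction of \<open>u\<close> to the open set \<open>V\<close> is an integrable function.\<close>

definition distr_integrable_on :: "real set \<Rightarrow> distr \<Rightarrow> bool" where
  "distr_integrable_on V u \<longleftrightarrow> (\<exists>v. set_integrable lebesgue V v \<and> distr_eq V u (reg_distr V v))"

definition heaviside :: "real \<Rightarrow> real" where
  "heaviside t = (if t < 0 then 0 else 1)"

definition g_kernel :: "real \<Rightarrow> real \<Rightarrow> real" where
  "g_kernel \<alpha> t = heaviside t * t powr (\<alpha> - 1) / Gamma \<alpha>"

text \<open>The distribution on \<open>(-\<infinity>,T)\<close> identified with \<open>f\<close> in \<open>L1loc T\<close>.\<close>

definition L1loc_distr :: "ereal \<Rightarrow> (real \<Rightarrow> real) \<Rightarrow> distr" where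
  "L1loc_distr T f = reg_distr {t. ereal t < T} (\<lambda>t. heaviside t * f t)"

definition has_right_value :: "(real \<Rightarrow> real) \<Rightarrow> real \<Rightarrow> bool" where
  "has_right_value \<phi> c \<longleftrightarrow>
     ((\<lambda>t. 1 / t * (LINT s:{0<..<t}|lebesgue. \<bar>\<phi> s - c\<bar>)) \<longlongrightarrow> 0) (at_right 0)"

definition X_space :: "ereal \<Rightarrow> (real \<Rightarrow> real) set" where
  "X_space T = {\<phi> \<in> L1loc T. \<exists>c. has_right_value \<phi> c}"

definition right_value :: "(real \<Rightarrow> real) \<Rightarrow> real" where
  "right_value \<phi> = (THE c. has_right_value \<phi> c)"

text \<open>\<open>J\<^sub>-\<^sub>\<gamma> \<phi>\<close> for \<open>0 < \<gamma> < 1\<close>; the inner integral converges for almost every \<open>t\<close>.\<close>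

definition J_neg :: "ereal \<Rightarrow> real \<Rightarrow> (real \<Rightarrow> real) \<Rightarrow> distr" where
  "J_neg T \<gamma> \<phi> = distr_deriv (L1loc_distr T
     (\<lambda>t. 1 / Gamma (1 - \<gamma>) * (LINT s:{0<..<t}|lebesgue. (t - s) powr (- \<gamma>) * \<phi> s)))"

definition caputo_deriv :: "ereal \<Rightarrow> real \<Rightarrow> (real \<Rightarrow> real) \<Rightarrow> distr" where
  "caputo_deriv T \<gamma> \<phi> =
     (\<lambda>\<eta>. J_neg T \<gamma> \<phi> \<eta> - right_value \<phi> * reg_distr {t. ereal t < T} (g_kernel (1 - \<gamma>)) \<eta>)"

definition abs_cont_on :: "real set \<Rightarrow> (real \<Rightarrow> real) \<Rightarrow> bool" where
  "abs_cont_on I f \<longleftrightarrow> (\<forall>\<epsilon>>0. \<exists>\<delta>>0. \<forall>(n::nat) a b.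
     (\<forall>i<n. a i \<in> I \<and> b i \<in> I \<and> a i \<le> b i) \<and>
     disjoint_family_on (\<lambda>i. {a i<..<b i}) {..<n} \<and>
     (\<Sum>i<n. b i - a i) < \<delta> \<longrightarrow> (\<Sum>i<n. \<bar>f (b i) - f (a i)\<bar>) < \<epsilon>)"

end

theory Submission
  imports Defs
begin

text \<open>
  On each \<open>(0,M)\<close> with \<open>M < T\<close> let \<open>w\<close> be the integrable distributional derivative of \<open>\<phi>\<close>. Since
  \<open>\<phi> - \<integral>\<^sub>0\<^sup>t w\<close> has derivative zero, it is a constant by the lemma of du Bois-Reymond, and the
  constant is \<open>\<phi>(0+)\<close>. The functions \<open>\<phi>(0+) + \<integral>\<^sub>0\<^sup>t w\<close> glue to an absolutely continuous version
  \<open>\<psi>\<close> with \<open>\<psi>' = w\<close> almost everywhere. Pairing the convolution of \<open>\<psi>\<close> and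
  \<open>k(t) = t\<^sup>-\<^sup>\<gamma>\<close> with \<open>f'\<close>, Fubini's theorem moves the derivative from the test function \<open>f\<close> to
  \<open>\<psi>\<close>, and the boundary term at \<open>0\<close> is cancelled by \<open>\<phi>(0+) g\<^sub>1\<^sub>-\<^sub>\<gamma>\<close>. As \<open>f\<close> vanishes beyond some
  \<open>M < T\<close>, the kernel may be cut off at \<open>M\<close>, which makes all functions integrable on the line.
\<close>

subsection \<open>Smooth functions\<close>

text \<open>The hypothesis supplies a derivative separately for each \<open>M\<close>, with no
  relation between the choices, and \<open>T\<close> may be infinite. What ties the local
  representations together is the constant: \<open>prim w\<close> is continuous and vanishes at
  \<open>0\<close>, so the averages of \<open>\<bar>\<phi> - d\<bar>\<close> tend to
  \<open>\<bar>c - d\<bar>\<close>, and \<open>c\<close> is singled out as the value at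
  \<open>0+\<close> whatever \<open>M\<close> is. For two bounds, the functions
  \<open>c + prim w\<close> then agree almost everywhere on the common interval, hence everywhere by
  continuity.

  Integration by parts never differentiates the rough function. As \<open>prim w\<close> is itself
  an integral over a half-line, interchanging the integrals puts the half-line on the test side,
  where the fundamental theorem of calculus meets only smooth functions. Differentiability of
  \<open>prim w\<close> almost everywhere enters at two places: to conclude that a function with
  zero integral over all intervals vanishes, and to identify \<open>deriv \<psi>\<close> with
  \<open>w\<close>.\<close>

fun diff_times :: "nat \<Rightarrow> (real \<Rightarrow> real) \<Rightarrow> bool" where
  "diff_times 0 f \<longleftrightarrow> True"
| "diff_times (Suc n) f \<longleftrightarrow> (\<forall>x. f differentiable (at x)) \<and> diff_times n (deriv f)"

text \<open>\<open>diff_times\<close> takes the derivative inside the recursive call, so that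
  closure properties follow by induction on the order with the function arbitrary. The iterates of
  \<open>deriv\<close> in \<open>test_fun\<close> are matched by
  \<open>smooth_iff_higher_deriv\<close>.\<close>

definition smooth :: "(real \<Rightarrow> real) \<Rightarrow> bool" where
  "smooth f \<longleftrightarrow> (\<forall>n. diff_times n f)"

lemma smooth_iff_higher_deriv:
  "smooth f \<longleftrightarrow> (\<forall>n x. ((deriv ^^ n) f) differentiable (at x))"
proof -
  have iff: "diff_times n f \<longleftrightarrow> (\<forall>k<n. \<forall>x. ((deriv ^^ k) f) differentiable (at x))" for n
  proof (induction n arbitrary: f)
    case (Suc n)
    have eq: "(deriv ^^ k) (deriv f) = (deriv ^^ Suc k) f" for k
      by (simp add: funpow_swap1)
    show ?case
      by (simp only: diff_times.simps Suc eq All_less_Suc2) simp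
  qed simp
  show ?thesis
    unfolding smooth_def iff by blast
qed

lemma diff_times_Suc_D: "diff_times (Suc n) f \<Longrightarrow> diff_times n f"
  by (induction n arbitrary: f) auto

lemma differentiable_imp_deriv: "f differentiable (at x) \<Longrightarrow> (f has_real_derivative deriv f x) (at x)"
  for f :: "real \<Rightarrow> real"
  using DERIV_deriv_iff_real_differentiable by blast

text \<open>Lets each induction below name the derivative by an explicit formula, so that
  \<open>deriv\<close> never has to be computed.\<close>

lemma diff_times_SucI:
  assumes "\<And>x. (f has_real_derivative g x) (at x)" "diff_times n g"
  shows "diff_times (Suc n) f"
proof -
  have "deriv f = g"
    using assms(1) by (auto intro: DERIV_imp_deriv)
  then show ?thesis
    using assms real_differentiable_def by auto
qed

lemma diff_times_add: "diff_times n f \<Longrightarrow> diff_times n g \<Longrightarrow> diff_times n (\<lambda>x. f x + g x)"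
proof (induction n arbitrary: f g)
  case (Suc n)
  show ?case
    by (rule diff_times_SucI[OF DERIV_add])
       (use Suc in \<open>auto intro: differentiable_imp_deriv\<close>)
qed simp

lemma diff_times_cmult: "diff_times n f \<Longrightarrow> diff_times n (\<lambda>x. c * f x)"
proof (induction n arbitrary: f)
  case (Suc n)
  show ?case
    by (rule diff_times_SucI[OF DERIV_cmult])
       (use Suc in \<open>auto intro: differentiable_imp_deriv\<close>)
qed simp

lemma diff_times_mult: "diff_times n f \<Longrightarrow> diff_times n g \<Longrightarrow> diff_times n (\<lambda>x. f x * g x)"
proof (induction n arbitrary: f g)
  case (Suc n)
  have "diff_times n (\<lambda>x. deriv f x * g x + deriv g x * f x)"
    using Suc.prems by (intro diff_times_add Suc.IH diff_times_Suc_D[of n f] diff_times_Suc_D[of n g]) auto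
  then show ?case
    by (intro diff_times_SucI[OF DERIV_mult])
       (use Suc.prems in \<open>auto intro: differentiable_imp_deriv\<close>)
qed simp

lemma diff_times_affine: "diff_times n f \<Longrightarrow> diff_times n (\<lambda>x. f (a * x + b))"
proof (induction n arbitrary: f)
  case (Suc n)
  have "((\<lambda>x. f (a * x + b)) has_real_derivative a * deriv f (a * x + b)) (at x)" for x
  proof -
    have "(f has_real_derivative deriv f (a * x + b)) (at (a * x + b))"
      using Suc.prems by (auto intro: differentiable_imp_deriv)
    then have "((\<lambda>x. f (a * x + b)) has_real_derivative deriv f (a * x + b) * a) (at x)"
      by (rule DERIV_chain2) (auto intro!: derivative_eq_intros)
    then show ?thesis
      by (simp add: mult.commute)
  qed
  then show ?case
    by (rule diff_times_SucI) (use Suc in \<open>auto intro: diff_times_cmult\<close>)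
qed simp

text \<open>The family \<open>exp (- 1 / x) / x ^ j\<close> is closed under differentiation up to linear combinations.\<close>

definition flat_exp :: "nat \<Rightarrow> real \<Rightarrow> real" where
  "flat_exp j x = (if x > 0 then exp (- inverse x) * inverse x ^ j else 0)"

text \<open>With \<open>y = 1 / x\<close> this is the fact that the exponential outgrows every
  power.\<close>

lemma flat_exp_tendsto_0: "(flat_exp j \<longlongrightarrow> 0) (at 0)"
proof -
  have "((\<lambda>x::real. inverse x ^ j / exp (inverse x)) \<longlongrightarrow> 0) (at_right 0)"
    by (rule filterlim_compose[OF tendsto_power_div_exp_0 filterlim_inverse_at_top_right])
  moreover have "\<forall>\<^sub>F x in at_right 0. inverse x ^ j / exp (inverse x) = flat_exp j x"
    by (auto simp: eventually_at_filter flat_exp_def exp_minus field_simps)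
  ultimately have "(flat_exp j \<longlongrightarrow> 0) (at_right 0)"
    by (rule Lim_transform_eventually)
  moreover have "(flat_exp j \<longlongrightarrow> 0) (at_left 0)"
    by (rule tendsto_eventually) (auto simp: eventually_at_filter flat_exp_def)
  ultimately show ?thesis
    by (simp add: filterlim_split_at)
qed

lemma flat_exp_has_derivative:
  "(flat_exp j has_real_derivative flat_exp (j + 2) x + (- real j) * flat_exp (j + 1) x) (at x)"
proof -
  consider "x > 0" | "x < 0" | "x = 0" by linarith
  then show ?thesis
  proof cases
    case 1
    have "((\<lambda>x. exp (- inverse x) * inverse x ^ j) has_real_derivative
        flat_exp (j + 2) x + (- real j) * flat_exp (j + 1) x) (at x)"
    \<comment> \<open>The split keeps the exponent \<open>j - 1\<close> of the power rule from being
      a truncated subtraction.\<close>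
    proof (cases j)
      case 0
      then show ?thesis
        using 1 by (auto intro!: derivative_eq_intros simp: flat_exp_def field_simps power2_eq_square)
    next
      case (Suc i)
      have "((\<lambda>x. inverse x ^ Suc i) has_real_derivative - real (Suc i) * inverse x ^ (i + 2)) (at x)"
        using 1 by (intro DERIV_cong[OF DERIV_power[OF DERIV_inverse]])
          (auto simp: power_add power2_eq_square algebra_simps)
      moreover have "((\<lambda>x. exp (- inverse x)) has_real_derivative exp (- inverse x) * inverse x ^ 2) (at x)"
        using 1 by (auto intro!: derivative_eq_intros simp: power2_eq_square)
      ultimately show ?thesis
        unfolding Suc by (intro DERIV_cong[OF DERIV_mult])
          (use 1 in \<open>auto simp: flat_exp_def power2_eq_square algebra_simps\<close>)
    qed
    then show ?thesis
      by (rule has_field_derivative_transform_within_open[where S = "{0<..}"])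
         (use 1 in \<open>auto simp: flat_exp_def\<close>)
  next
    case 2
    have "((\<lambda>x. 0) has_real_derivative flat_exp (j + 2) x + (- real j) * flat_exp (j + 1) x) (at x)"
      using 2 by (auto simp: flat_exp_def)
    then show ?thesis
      by (rule has_field_derivative_transform_within_open[where S = "{..<0}"])
         (use 2 in \<open>auto simp: flat_exp_def\<close>)
  next
    \<comment> \<open>The difference quotient of \<open>flat_exp j\<close> at \<open>0\<close> is
      \<open>flat_exp (Suc j)\<close>, so the limit is already known.\<close>
    case 3
    have "\<forall>\<^sub>F h in at 0. flat_exp (Suc j) h = (flat_exp j (0 + h) - flat_exp j 0) / h"
      by (rule always_eventually) (simp add: flat_exp_def divide_inverse mult_ac)
    then have "((\<lambda>h. (flat_exp j (0 + h) - flat_exp j 0) / h) \<longlongrightarrow> 0) (at 0)"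
      by (rule Lim_transform_eventually[OF flat_exp_tendsto_0])
    then show ?thesis
      using 3 by (simp add: DERIV_def flat_exp_def)
  qed
qed

lemma smooth_flat_exp: "smooth (flat_exp j)"
proof -
  have "diff_times n (flat_exp j)" for n j
  proof (induction n arbitrary: j)
    case (Suc n)
    show ?case
      by (rule diff_times_SucI[OF flat_exp_has_derivative] diff_times_add diff_times_cmult Suc)+
  qed simp
  then show ?thesis
    by (simp add: smooth_def)
qed

lemma smooth_mult: "smooth f \<Longrightarrow> smooth g \<Longrightarrow> smooth (\<lambda>x. f x * g x)"
  by (simp add: smooth_def diff_times_mult)

lemma smooth_add: "smooth f \<Longrightarrow> smooth g \<Longrightarrow> smooth (\<lambda>x. f x + g x)"
  by (simp add: smooth_def diff_times_add)

lemma smooth_cmult: "smooth f \<Longrightarrow> smooth (\<lambda>x. c * f x)"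
  by (simp add: smooth_def diff_times_cmult)

lemma smooth_affine: "smooth f \<Longrightarrow> smooth (\<lambda>x. f (a * x + b))"
  by (simp add: smooth_def diff_times_affine)

lemma smooth_has_derivative: "smooth f \<Longrightarrow> (f has_real_derivative deriv f x) (at x)"
  by (rule differentiable_imp_deriv) (use diff_times.simps(2)[of 0 f] in \<open>auto simp: smooth_def simp del: diff_times.simps\<close>)

lemma smooth_deriv: "smooth f \<Longrightarrow> smooth (deriv f)"
  by (simp add: smooth_def) (meson diff_times.simps(2))

text \<open>Used to see that the primitive of a test function of total integral zero is again a test
  function.\<close>

lemma smooth_antideriv:
  assumes "\<And>x. (f has_real_derivative g x) (at x)" "smooth g"
  shows "smooth f"
  unfolding smooth_def
proof
  fix n show "diff_times n f"
    using assms diff_times_SucI[of f g] by (cases n) (auto simp: smooth_def)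
qed

lemma smooth_continuous_on: "smooth f \<Longrightarrow> continuous_on A f"
  by (meson DERIV_isCont continuous_at_imp_continuous_on smooth_has_derivative)

section \<open>Test functions and their supports\<close>

lemma test_funI:
  assumes "smooth f" "\<And>x. x \<notin> {p..q} \<Longrightarrow> f x = 0" "{p..q} \<subseteq> U"
  shows "f \<in> test_fun U"
proof -
  have "closure {x. f x \<noteq> 0} \<subseteq> {p..q}"
    by (intro closure_minimal subsetI) (use assms(2) in auto)
  moreover have "compact (closure {x. f x \<noteq> 0})"
    using calculation by (metis closed_closure compact_Icc compact_Int_closed inf.absorb_iff2)
  ultimately show ?thesis
    using assms by (auto simp: test_fun_def smooth_iff_higher_deriv)
qed

text \<open>\<open>K\<close> is the closed support. Its complement is open, so \<open>f\<close>
  vanishes near each point outside, and with it the derivative.\<close>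

lemma test_funE:
  assumes "f \<in> test_fun U"
  obtains K where "compact K" "K \<subseteq> U" "\<And>x. x \<notin> K \<Longrightarrow> f x = 0" "\<And>x. x \<notin> K \<Longrightarrow> deriv f x = 0"
proof
  let ?K = "closure {x. f x \<noteq> 0}"
  show "compact ?K" "?K \<subseteq> U"
    using assms by (auto simp: test_fun_def)
  show *: "f x = 0" if "x \<notin> ?K" for x
    using that closure_subset[of "{x. f x \<noteq> 0}"] by auto
  show "deriv f x = 0" if "x \<notin> ?K" for x
  proof (rule DERIV_imp_deriv)
    have "open (- ?K)" "x \<in> - ?K"
      using that by (simp_all add: open_Compl)
    then show "(f has_real_derivative 0) (at x)"
      by (rule has_field_derivative_transform_within_open[OF DERIV_const[of 0]]) (metis * ComplD)
  qed
qed

lemma test_fun_smooth: "f \<in> test_fun U \<Longrightarrow> smooth f"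
  by (simp add: test_fun_def smooth_iff_higher_deriv)

subsection \<open>Convolutions and antiderivatives of integrable functions\<close>

lemma integrable_pair_mult:
  fixes f g :: "real \<Rightarrow> real"
  assumes f: "integrable lborel f" and g: "integrable lborel g"
  shows "integrable (lborel \<Otimes>\<^sub>M lborel) (\<lambda>(x, y). f x * g y)"
proof -
  note [measurable] = borel_measurable_integrable[OF f] borel_measurable_integrable[OF g]
  show ?thesis
  proof (rule lborel_pair.Fubini_integrable)
    have "integrable lborel (\<lambda>x. \<bar>f x\<bar> * (\<integral>y. \<bar>g y\<bar> \<partial>lborel))"
      using f by (intro integrable_mult_left integrable_abs)
    then show "integrable lborel (\<lambda>x. \<integral>y. norm (case (x, y) of (x, y) \<Rightarrow> f x * g y) \<partial>lborel)"
      by (simp add: abs_mult)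
  qed (use g in \<open>auto intro!: AE_I2 integrable_mult_right\<close>)
qed

text \<open>By translation invariance the integral of \<open>\<bar>k (t - s)\<bar>\<close> over
  \<open>t\<close> does not depend on \<open>s\<close>, so the double integral of the absolute value
  factors.\<close>

lemma integrable_pair_convolution:
  fixes f k :: "real \<Rightarrow> real"
  assumes f: "integrable lborel f" and k: "integrable lborel k"
  shows "integrable (lborel \<Otimes>\<^sub>M lborel) (\<lambda>(s, t). f s * k (t - s))"
proof -
  note [measurable] = borel_measurable_integrable[OF f] borel_measurable_integrable[OF k]
  have shift: "(\<integral>t. \<bar>k (t - s)\<bar> \<partial>lborel) = (\<integral>t. \<bar>k t\<bar> \<partial>lborel)" for s
    using lborel_integral_real_affine[of 1 "\<lambda>t. \<bar>k t\<bar>" "- s"] by (simp add: algebra_simps)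
  have k': "integrable lborel (\<lambda>t. k (t - s))" for s
    using lborel_integrable_real_affine[OF k, of 1 "- s"] by simp
  show ?thesis
  proof (rule lborel_pair.Fubini_integrable)
    have "integrable lborel (\<lambda>s. \<bar>f s\<bar> * (\<integral>t. \<bar>k t\<bar> \<partial>lborel))"
      using f by (intro integrable_mult_left integrable_abs)
    then show "integrable lborel (\<lambda>s. \<integral>t. norm (case (s, t) of (s, t) \<Rightarrow> f s * k (t - s)) \<partial>lborel)"
      by (simp add: abs_mult shift)
  qed (use k' in \<open>auto intro!: AE_I2 integrable_mult_right\<close>)
qed

lemma
  fixes f k :: "real \<Rightarrow> real"
  assumes f: "integrable lborel f" and k: "integrable lborel k"
  shows AE_integrable_convolution: "AE t in lborel. integrable lborel (\<lambda>s. f s * k (t - s))"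
    and integrable_convolution: "integrable lborel (\<lambda>t. \<integral>s. f s * k (t - s) \<partial>lborel)"
  using lborel_pair.AE_integrable_snd[OF integrable_pair_convolution[OF f k]]
    lborel_pair.integrable_snd[OF integrable_pair_convolution[OF f k]] by auto

text \<open>The adjoint of convolution with \<open>k\<close> is correlation with \<open>k\<close>.
  Boundedness of \<open>p\<close> keeps the integrand below \<open>C\<close> times the one of the
  plain convolution, so Fubini applies. It is used in both directions: to move the kernel onto the
  test function, and to move it back.\<close>

lemma
  fixes f k p :: "real \<Rightarrow> real"
  assumes f: "integrable lborel f" and k: "integrable lborel k"
    and p[measurable]: "p \<in> borel_measurable borel" and bd: "\<And>t. \<bar>p t\<bar> \<le> C"
  shows integral_convolution_mult:
    "(\<integral>t. (\<integral>s. f s * k (t - s) \<partial>lborel) * p t \<partial>lborel) = (\<integral>s. f s * (\<integral>t. k (t - s) * p t \<partial>lborel) \<partial>lborel)"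
    and integrable_mult_correlation: "integrable lborel (\<lambda>s. f s * (\<integral>t. k (t - s) * p t \<partial>lborel))"
proof -
  note [measurable] = borel_measurable_integrable[OF f] borel_measurable_integrable[OF k]
  have int: "integrable (lborel \<Otimes>\<^sub>M lborel) (\<lambda>(s, t). f s * k (t - s) * p t)"
  proof (rule Bochner_Integration.integrable_bound)
    show "integrable (lborel \<Otimes>\<^sub>M lborel) (\<lambda>z. C * (case z of (s, t) \<Rightarrow> f s * k (t - s)))"
      by (intro integrable_mult_right integrable_pair_convolution f k)
    have "0 \<le> C"
      using bd[of 0] by linarith
    show "AE z in lborel \<Otimes>\<^sub>M lborel. norm (case z of (s, t) \<Rightarrow> f s * k (t - s) * p t)
        \<le> norm (C * (case z of (s, t) \<Rightarrow> f s * k (t - s)))"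
    proof (rule AE_I2, clarify)
      fix s t
      show "norm (f s * k (t - s) * p t) \<le> norm (C * (f s * k (t - s)))"
        using mult_left_mono[OF bd[of t], of "\<bar>f s * k (t - s)\<bar>"] \<open>0 \<le> C\<close> by (simp add: abs_mult mult_ac)
    qed
  qed measurable
  have "(\<integral>t. (\<integral>s. f s * k (t - s) \<partial>lborel) * p t \<partial>lborel) =
      (\<integral>t. (\<integral>s. f s * k (t - s) * p t \<partial>lborel) \<partial>lborel)"
    by simp
  also have "\<dots> = (\<integral>s. (\<integral>t. f s * k (t - s) * p t \<partial>lborel) \<partial>lborel)"
    by (rule lborel_pair.Fubini_integral[OF int])
  also have "\<dots> = (\<integral>s. f s * (\<integral>t. k (t - s) * p t \<partial>lborel) \<partial>lborel)"
    by (simp add: mult.assoc)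
  finally show "(\<integral>t. (\<integral>s. f s * k (t - s) \<partial>lborel) * p t \<partial>lborel) = (\<integral>s. f s * (\<integral>t. k (t - s) * p t \<partial>lborel) \<partial>lborel)" .
  show "integrable lborel (\<lambda>s. f s * (\<integral>t. k (t - s) * p t \<partial>lborel))"
    using lborel_pair.integrable_fst[OF int] by (simp add: mult.assoc)
qed

text \<open>Integrating from minus infinity needs no oriented integrals; for \<open>w\<close>
  vanishing on the negative half-line this is the usual primitive starting at
  \<open>0\<close>.\<close>

definition prim :: "(real \<Rightarrow> real) \<Rightarrow> real \<Rightarrow> real" where
  "prim w t = (\<integral>r. indicator {..<t} r * w r \<partial>lborel)"

text \<open>Both sides of the second claim integrate \<open>w r * p s\<close> over the half-plane
  \<open>r < s\<close>.\<close>

lemma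
  fixes w p :: "real \<Rightarrow> real"
  assumes w: "integrable lborel w" and p: "integrable lborel p"
  shows integrable_prim_mult: "integrable lborel (\<lambda>s. prim w s * p s)"
    and integral_prim_mult:
      "(\<integral>s. prim w s * p s \<partial>lborel) = (\<integral>r. w r * (\<integral>s. indicator {r<..} s * p s \<partial>lborel) \<partial>lborel)"
proof -
  note [measurable] = borel_measurable_integrable[OF w] borel_measurable_integrable[OF p]
  have int: "integrable (lborel \<Otimes>\<^sub>M lborel) (\<lambda>(r, s). indicator {..<s} r * w r * p s)"
  proof (rule Bochner_Integration.integrable_bound[OF integrable_pair_mult[OF w p]])
    \<comment> \<open>The indicator of a set depending on \<open>s\<close> is rewritten as a
      condition on the pair, whose measurability is immediate.\<close>
    have "(\<lambda>(r, s). (if r < s then w r * p s else 0)) \<in> borel_measurable (lborel \<Otimes>\<^sub>M lborel)"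
      by measurable
    then show "(\<lambda>(r, s). indicator {..<s} r * w r * p s) \<in> borel_measurable (lborel \<Otimes>\<^sub>M lborel)"
      by (rule back_subst[where P = "\<lambda>f. f \<in> borel_measurable _"]) (auto simp: fun_eq_iff)
  qed (auto intro!: AE_I2 split: split_indicator)
  have eq: "indicator {..<s} r * w r * p s = w r * (indicator {r<..} s * p s)" for r s
    by (auto split: split_indicator)
  have "(\<integral>s. (\<integral>r. indicator {..<s} r * w r * p s \<partial>lborel) \<partial>lborel) =
      (\<integral>r. (\<integral>s. indicator {..<s} r * w r * p s \<partial>lborel) \<partial>lborel)"
    by (rule lborel_pair.Fubini_integral[OF int])
  also have "\<dots> = (\<integral>r. w r * (\<integral>s. indicator {r<..} s * p s \<partial>lborel) \<partial>lborel)"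
    by (simp only: eq integral_mult_right_zero)
  finally show "(\<integral>s. prim w s * p s \<partial>lborel) = (\<integral>r. w r * (\<integral>s. indicator {r<..} s * p s \<partial>lborel) \<partial>lborel)"
    by (simp add: prim_def)
  show "integrable lborel (\<lambda>s. prim w s * p s)"
    using lborel_pair.integrable_snd[OF int] by (simp add: prim_def)
qed

text \<open>The theorem speaks of \<open>lebesgue\<close>, whereas Fubini and the affine
  substitutions are applied over \<open>lborel\<close>. All passages between the two go through a
  Borel function that agrees almost everywhere.\<close>

lemma
  fixes f g :: "real \<Rightarrow> real"
  assumes ae: "AE x in lebesgue. f x = g x" and g: "g \<in> borel_measurable borel"
  shows borel_measurable_lebesgue_AE: "f \<in> borel_measurable lebesgue"
    and integrable_lebesgue_AE: "integrable lebesgue f \<longleftrightarrow> integrable lborel g"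
    and integral_lebesgue_AE: "integral\<^sup>L lebesgue f = integral\<^sup>L lborel g"
proof -
  have gl: "g \<in> borel_measurable lebesgue"
    using g by (simp add: measurable_completion)
  show fl: "f \<in> borel_measurable lebesgue"
    by (rule borel_measurable_AE[OF gl]) (use ae in \<open>auto elim: eventually_mono\<close>)
  show "integrable lebesgue f \<longleftrightarrow> integrable lborel g"
    using integrable_cong_AE[OF fl gl ae] integrable_completion[of g lborel] g by simp
  show "integral\<^sup>L lebesgue f = integral\<^sup>L lborel g"
    using integral_cong_AE[OF fl gl ae] integral_completion[of g lborel] g by simp
qed

lemma integrable_lebesgue_imp_lborel:
  fixes f :: "real \<Rightarrow> real"
  assumes "integrable lebesgue f"
  obtains g where "integrable lborel g" "AE x in lebesgue. f x = g x"
proof -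
  obtain g where "g \<in> borel_measurable lborel" "AE x in lborel. f x = g x"
    using completion_ex_borel_measurable_real[OF borel_measurable_integrable[OF assms]] by auto
  then show ?thesis
    using that[of g] assms integrable_lebesgue_AE[of f g] by (simp add: AE_completion)
qed

lemma smooth_borel_measurable: "smooth f \<Longrightarrow> f \<in> borel_measurable borel"
  by (intro borel_measurable_continuous_onI smooth_continuous_on)

section \<open>Integration by parts against smooth functions of compact support\<close>

lemma continuous_compact_support:
  fixes f :: "real \<Rightarrow> real"
  assumes cont: "continuous_on UNIV f" and K: "compact K" "\<And>x. x \<notin> K \<Longrightarrow> f x = 0"
  shows integrable_compact_support: "integrable lborel f"
    and bounded_compact_support: "\<exists>C. \<forall>x. \<bar>f x\<bar> \<le> C"
proof -
  have cK: "continuous_on K f"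
    using cont continuous_on_subset by blast
  have "integrable lborel (\<lambda>x. indicator K x *\<^sub>R f x)"
    using borel_integrable_compact[OF K(1) cK] by simp
  moreover have "(\<lambda>x. indicator K x *\<^sub>R f x) = f"
    using K(2) by (auto simp: indicator_def fun_eq_iff)
  ultimately show "integrable lborel f"
    by simp
  obtain B where B: "B > 0" "\<And>x. x \<in> K \<Longrightarrow> \<bar>f x\<bar> \<le> B"
    using compact_imp_bounded[OF compact_continuous_image[OF cK K(1)]] by (auto simp: bounded_pos)
  have "\<bar>f x\<bar> \<le> B" for x
    using B K(2)[of x] by (cases "x \<in> K") auto
  then show "\<exists>C. \<forall>x. \<bar>f x\<bar> \<le> C"
    by blast
qed

lemma integral_deriv_compact_support:
  fixes f :: "real \<Rightarrow> real"
  assumes f: "smooth f" and K: "compact K" "\<And>x. x \<notin> K \<Longrightarrow> f x = 0" "\<And>x. x \<notin> K \<Longrightarrow> deriv f x = 0"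
  shows "(\<integral>s. indicator {r<..} s * deriv f s \<partial>lborel) = - f r"
proof -
  obtain B where B: "B > 0" "\<And>x. x \<in> K \<Longrightarrow> \<bar>x\<bar> \<le> B"
    using compact_imp_bounded[OF K(1)] by (auto simp: bounded_pos)
  \<comment> \<open>A point right of both \<open>r\<close> and the whole of \<open>K\<close>, so
    that \<open>f b = 0\<close> in the fundamental theorem of calculus.\<close>
  define b where "b = max r B + 1"
  have b: "r \<le> b" "\<And>x. x \<ge> b \<Longrightarrow> x \<notin> K"
    using B by (force simp: b_def)+
  have "(\<integral>s. indicator {r<..} s * deriv f s \<partial>lborel) = (\<integral>s. deriv f s * indicator {r..b} s \<partial>lborel)"
  proof (rule integral_cong_AE)
    have "AE s in lborel. s \<noteq> r"
      by (rule AE_lborel_singleton)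
    then show "AE s in lborel. indicator {r<..} s * deriv f s = deriv f s * indicator {r..b} s"
    proof eventually_elim
      case (elim s)
      then show ?case
        using K(3)[of s] b(2)[of s] by (cases "s \<ge> b") (auto split: split_indicator)
    qed
  qed (use smooth_borel_measurable[OF smooth_deriv[OF f]] in measurable)
  also have "\<dots> = f b - f r"
    by (rule integral_FTC_Icc_real[OF b(1)])
      (auto intro: smooth_has_derivative[OF f] DERIV_isCont[OF smooth_has_derivative[OF smooth_deriv[OF f]]])
  finally show ?thesis
    using K(2)[OF b(2)[of b]] by simp
qed

text \<open>In other words, \<open>w\<close> is the distributional derivative of
  \<open>prim w\<close>.\<close>

lemma integral_prim_mult_deriv:
  assumes w: "integrable lborel w"
    and f: "smooth f" and K: "compact K" "\<And>x. x \<notin> K \<Longrightarrow> f x = 0" "\<And>x. x \<notin> K \<Longrightarrow> deriv f x = 0"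
  shows "(\<integral>s. prim w s * deriv f s \<partial>lborel) = - (\<integral>r. w r * f r \<partial>lborel)"
proof -
  have "integrable lborel (deriv f)"
    by (rule integrable_compact_support[OF smooth_continuous_on[OF smooth_deriv[OF f]] K(1,3)])
  from integral_prim_mult[OF w this] show ?thesis
    by (simp add: integral_deriv_compact_support[OF f K])
qed

text \<open>Substituting \<open>t = s - y\<close> turns the correlation into a convolution with the
  reflected kernel, in which \<open>s\<close> occurs only in the smooth factor. Fubini then allows
  integrating \<open>deriv f (s - y)\<close> over \<open>s > r\<close> first, which gives
  \<open>- f (r - y)\<close>.\<close>

lemma integral_correlation_deriv:
  fixes f k :: "real \<Rightarrow> real"
  assumes k: "integrable lborel k"
    and f: "smooth f" and K: "compact K" "\<And>x. x \<notin> K \<Longrightarrow> f x = 0" "\<And>x. x \<notin> K \<Longrightarrow> deriv f x = 0"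
  shows "integrable lborel (\<lambda>s. \<integral>t. k (t - s) * deriv f t \<partial>lborel)"
    and "(\<integral>s. indicator {r<..} s * (\<integral>t. k (t - s) * deriv f t \<partial>lborel) \<partial>lborel) =
      - (\<integral>t. k (t - r) * f t \<partial>lborel)"
proof -
  note [measurable] = borel_measurable_integrable[OF k] smooth_borel_measurable[OF f]
    smooth_borel_measurable[OF smooth_deriv[OF f]]
  have f': "integrable lborel (deriv f)"
    by (rule integrable_compact_support[OF smooth_continuous_on[OF smooth_deriv[OF f]] K(1,3)])
  have k': "integrable lborel (\<lambda>x. k (- x))"
    using lborel_integrable_real_affine[OF k, of "-1" 0] by simp
  have "integrable lborel (\<lambda>s. \<integral>t. deriv f t * k (- (s - t)) \<partial>lborel)"
    by (rule integrable_convolution[OF f' k'])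
  then show "integrable lborel (\<lambda>s. \<integral>t. k (t - s) * deriv f t \<partial>lborel)"
    by (simp add: mult.commute)
  have shift: "(\<integral>t. k (t - s) * p t \<partial>lborel) = (\<integral>y. k (- y) * p (s - y) \<partial>lborel)" for s and p :: "real \<Rightarrow> real"
    using lborel_integral_real_affine[of "-1" "\<lambda>t. k (t - s) * p t" s] by simp
  have shift': "(\<integral>s. indicator {r<..} s * (k (- y) * deriv f (s - y)) \<partial>lborel) = k (- y) * - f (r - y)" for y
  proof -
    have "(\<integral>s. indicator {r<..} s * (k (- y) * deriv f (s - y)) \<partial>lborel) =
        (\<integral>s. k (- y) * (indicator {r<..} s * deriv f (s - y)) \<partial>lborel)"
      by (simp only: mult.left_commute)
    also have "\<dots> = k (- y) * (\<integral>s. indicator {r<..} s * deriv f (s - y) \<partial>lborel)"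
      by simp
    also have "(\<integral>s. indicator {r<..} s * deriv f (s - y) \<partial>lborel) =
        (\<integral>u. indicator {r - y<..} u * deriv f u \<partial>lborel)"
      by (subst lborel_integral_real_affine[of 1 _ y]) (auto simp: indicator_def diff_less_eq add.commute)
    finally show ?thesis
      by (simp add: integral_deriv_compact_support[OF f K])
  qed
  have int: "integrable (lborel \<Otimes>\<^sub>M lborel) (\<lambda>(y, s). indicator {r<..} s * (k (- y) * deriv f (s - y)))"
    by (rule Bochner_Integration.integrable_bound[OF integrable_pair_convolution[OF k' f']])
       (auto intro!: AE_I2 split: split_indicator)
  show "(\<integral>s. indicator {r<..} s * (\<integral>t. k (t - s) * deriv f t \<partial>lborel) \<partial>lborel) =
      - (\<integral>t. k (t - r) * f t \<partial>lborel)"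
  proof -
    have "(\<integral>s. indicator {r<..} s * (\<integral>t. k (t - s) * deriv f t \<partial>lborel) \<partial>lborel) =
        (\<integral>s. (\<integral>y. indicator {r<..} s * (k (- y) * deriv f (s - y)) \<partial>lborel) \<partial>lborel)"
      by (simp add: shift)
    also have "\<dots> = (\<integral>y. (\<integral>s. indicator {r<..} s * (k (- y) * deriv f (s - y)) \<partial>lborel) \<partial>lborel)"
      by (rule lborel_pair.Fubini_integral[OF int])
    also have "\<dots> = - (\<integral>t. k (t - r) * f t \<partial>lborel)"
      by (simp add: shift' shift)
    finally show ?thesis .
  qed
qed

lemma prim_eq_0:
  fixes w :: "real \<Rightarrow> real"
  assumes "\<And>r. r \<le> 0 \<Longrightarrow> w r = 0" "t \<le> 0"
  shows "prim w t = 0"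
  using assms by (auto simp: prim_def indicator_def intro!: Bochner_Integration.integral_eq_zero_AE AE_I2)

lemma convolution_prim_mult_deriv:
  fixes f k w :: "real \<Rightarrow> real" and c M :: real
  defines "F \<equiv> \<lambda>s. indicator {0<..<M} s * (c + prim w s)"
  assumes k: "integrable lborel k" "\<And>x. x \<le> 0 \<Longrightarrow> k x = 0"
    and w: "integrable lborel w" "\<And>r. r \<le> 0 \<Longrightarrow> w r = 0"
    and f: "smooth f" and K: "compact K" "\<And>x. x \<notin> K \<Longrightarrow> f x = 0" "\<And>x. x \<notin> K \<Longrightarrow> deriv f x = 0"
    and M: "K \<subseteq> {..<M}"
  shows "(\<integral>t. (\<integral>s. F s * k (t - s) \<partial>lborel) * deriv f t \<partial>lborel) =
      - c * (\<integral>t. k t * f t \<partial>lborel) - (\<integral>t. (\<integral>s. w s * k (t - s) \<partial>lborel) * f t \<partial>lborel)"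
proof -
  \<comment> \<open>Moving the convolution onto the test function gives \<open>P\<close>, whose integral over \<open>(r,\<infinity>)\<close>
    is minus the correlation of \<open>k\<close> and \<open>f\<close> at \<open>r\<close>; the jump \<open>c\<close> at \<open>0\<close> contributes the case \<open>r = 0\<close>.\<close>
  define P where "P = (\<lambda>s. \<integral>t. k (t - s) * deriv f t \<partial>lborel)"
  note [measurable] = smooth_borel_measurable[OF f] smooth_borel_measurable[OF smooth_deriv[OF f]]
  obtain C C' where bd: "\<And>t. \<bar>f t\<bar> \<le> C" "\<And>t. \<bar>deriv f t\<bar> \<le> C'"
    using bounded_compact_support[OF smooth_continuous_on[OF f] K(1,2)]
      bounded_compact_support[OF smooth_continuous_on[OF smooth_deriv[OF f]] K(1,3)] by blast
  have ind: "integrable lborel (indicator {0<..<M} :: real \<Rightarrow> real)"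
    using emeasure_lborel_box_finite[of 0 M] by (intro integrable_real_indicator) (auto simp: box_real)
  have "integrable lborel (\<lambda>s. c * indicator {0<..<M} s + prim w s * indicator {0<..<M} s)"
    using ind by (intro Bochner_Integration.integrable_add integrable_mult_right integrable_prim_mult w)
  then have F: "integrable lborel F"
    by (simp add: F_def algebra_simps)
  have P: "integrable lborel P"
    unfolding P_def by (rule integral_correlation_deriv(1)[OF k(1) f K])
  have P_ind: "(\<integral>s. indicator {r<..} s * P s \<partial>lborel) = - (\<integral>t. k (t - r) * f t \<partial>lborel)" for r
    unfolding P_def by (rule integral_correlation_deriv(2)[OF k(1) f K])
  \<comment> \<open>The cut at \<open>M\<close> makes the constant \<open>c\<close> integrable and
    loses nothing: if \<open>s \<ge> M\<close> and \<open>t \<in> K\<close>, then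
    \<open>t - s < 0\<close> and the kernel vanishes, so \<open>P s = 0\<close>. For
    \<open>s \<le> 0\<close> all terms vanish.\<close>
  have eq: "F s * P s = c * (indicator {0<..} s * P s) + prim w s * P s" for s
  proof -
    consider "s \<le> 0" | "0 < s" "s < M" | "0 < s" "M \<le> s" by linarith
    then show ?thesis
    proof cases
      case 1
      then show ?thesis
        by (simp add: F_def prim_eq_0[OF w(2)])
    next
      case 2
      then show ?thesis
        by (simp add: F_def algebra_simps)
    next
      case 3
      have "k (t - s) * deriv f t = 0" for t
      proof (cases "t \<in> K")
        case True
        then show ?thesis
          using 3 M k(2)[of "t - s"] by auto
      qed (simp add: K(3))
      then have "P s = 0"
        by (simp only: P_def) simp
      then show ?thesis
        by simp
    qed
  qed
  have "(\<integral>t. (\<integral>s. F s * k (t - s) \<partial>lborel) * deriv f t \<partial>lborel) = (\<integral>s. F s * P s \<partial>lborel)"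
    unfolding P_def by (rule integral_convolution_mult[OF F k(1) _ bd(2)]) measurable
  also have "\<dots> = (\<integral>s. c * (indicator {0<..} s * P s) + prim w s * P s \<partial>lborel)"
    by (simp only: eq)
  also have "\<dots> = c * (\<integral>s. indicator {0<..} s * P s \<partial>lborel) + (\<integral>s. prim w s * P s \<partial>lborel)"
    using integrable_mult_indicator[OF _ P, of "{0<..}"]
    by (subst Bochner_Integration.integral_add) (auto intro!: integrable_prim_mult[OF w(1) P])
  also have "\<dots> = - c * (\<integral>t. k t * f t \<partial>lborel) - (\<integral>r. w r * (\<integral>t. k (t - r) * f t \<partial>lborel) \<partial>lborel)"
    by (simp add: P_ind integral_prim_mult[OF w(1) P])
  \<comment> \<open>Having rid the test function of its derivative, the kernel is moved back, now
    onto \<open>w\<close>.\<close>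
  also have "(\<integral>r. w r * (\<integral>t. k (t - r) * f t \<partial>lborel) \<partial>lborel) =
      (\<integral>t. (\<integral>s. w s * k (t - s) \<partial>lborel) * f t \<partial>lborel)"
    by (rule integral_convolution_mult[OF w(1) k(1) _ bd(1), symmetric]) measurable
  finally show ?thesis .
qed

section \<open>Differentiability of primitives\<close>

lemma prim_diff:
  assumes w: "integrable lborel w" and "a \<le> b"
  shows "prim w b - prim w a = (\<integral>r. indicator {a<..<b} r * w r \<partial>lborel)"
proof -
  note [measurable] = borel_measurable_integrable[OF w]
  have int: "integrable lborel (\<lambda>r. indicator A r * w r)" if "A \<in> sets borel" for A
    using integrable_mult_indicator[OF _ w, of A] that by simp
  have "prim w b - prim w a = (\<integral>r. indicator {..<b} r * w r - indicator {..<a} r * w r \<partial>lborel)"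
    unfolding prim_def by (rule Bochner_Integration.integral_diff[symmetric]) (auto intro: int)
  \<comment> \<open>Subtraction leaves a half-open interval; dropping the null endpoint gives the
    open ones that occur in \<open>abs_cont_on\<close> and as limits of bumps, and that reflection
    preserves.\<close>
  also have "\<dots> = (\<integral>r. indicator {a<..<b} r * w r \<partial>lborel)"
  proof (rule integral_cong_AE)
    show "AE r in lborel. indicator {..<b} r * w r - indicator {..<a} r * w r = indicator {a<..<b} r * w r"
      using AE_lborel_singleton[of a]
      by eventually_elim (use \<open>a \<le> b\<close> in \<open>auto simp: indicator_def\<close>)
  qed measurable
  finally show ?thesis .
qed

lemma prim_diff_eq_integral:
  assumes w: "integrable lborel w" and "a \<le> b"
  shows "prim w b - prim w a = integral {a..b} w"
proof -
  note [measurable] = borel_measurable_integrable[OF w]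
  have "(\<integral>r. indicator {a<..<b} r * w r \<partial>lborel) = (\<integral>r. indicator {a..b} r *\<^sub>R w r \<partial>lborel)"
  proof (rule integral_cong_AE)
    show "AE r in lborel. indicator {a<..<b} r * w r = indicator {a..b} r *\<^sub>R w r"
      using AE_lborel_singleton[of a] AE_lborel_singleton[of b]
      by eventually_elim (auto simp: indicator_def)
  qed measurable
  also have "\<dots> = integral {a..b} w"
    using set_borel_integral_eq_integral(2)[of "{a..b}" w] integrable_mult_indicator[OF _ w, of "{a..b}"]
    by (simp add: set_integrable_def set_lebesgue_integral_def)
  finally show ?thesis
    using prim_diff[OF assms] by simp
qed

text \<open>One half of Lebesgue's differentiation theorem; the other half follows by reflection.\<close>

lemma integrable_average_tendsto_AE:
  fixes w :: "real \<Rightarrow> real"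
  assumes w: "integrable lborel w"
  shows "AE x in lebesgue. \<forall>e>0. \<exists>d>0. \<forall>h. 0 < h \<and> h < d \<longrightarrow> \<bar>(prim w (x + h) - prim w x) / h - w x\<bar> < e"
proof -
  have "w integrable_on cbox a b" for a b
    using integrable_on_lborel[OF w] integrable_on_subcbox[of w UNIV a b] by simp
  then show ?thesis
  proof (rule integrable_ccontinuous_explicit, goal_cases)
    case (1 N)
    have "AE x in lebesgue. x \<notin> N"
      using 1(1) by (intro AE_not_in) (simp add: negligible_iff_null_sets)
    then show ?case
    proof eventually_elim
      case (elim x)
      show ?case
      proof (intro allI impI)
        fix e :: real assume "e > 0"
        from 1(2)[OF elim this] obtain d where "d > 0" and d: "\<forall>h. 0 < h \<and> h < d \<longrightarrow>
            norm (integral (cbox x (x + h *\<^sub>R One)) w /\<^sub>R h ^ DIM(real) - w x) < e"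
          by auto
        have "\<bar>(prim w (x + h) - prim w x) / h - w x\<bar> < e" if "0 < h" "h < d" for h
          using d[rule_format, of h] that prim_diff_eq_integral[OF w, of x "x + h"]
          by (simp add: divide_inverse mult.commute)
        with \<open>d > 0\<close> show "\<exists>d>0. \<forall>h. 0 < h \<and> h < d \<longrightarrow> \<bar>(prim w (x + h) - prim w x) / h - w x\<bar> < e"
          by blast
      qed
    qed
  qed
qed

text \<open>A left difference quotient of \<open>prim w\<close> at \<open>x\<close> is a right
  difference quotient, at \<open>- x\<close>, of the primitive of the reflected function.\<close>

lemma prim_has_derivative_AE:
  assumes w: "integrable lborel w"
  shows "AE x in lebesgue. (prim w has_real_derivative w x) (at x)"
proof -
  have w': "integrable lborel (\<lambda>x. w (- x))"
    using lborel_integrable_real_affine[OF w, of "-1" 0] by simp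
  have refl: "prim (\<lambda>x. w (- x)) b - prim (\<lambda>x. w (- x)) a = prim w (- a) - prim w (- b)" if "a \<le> b" for a b
  proof -
    have "prim (\<lambda>x. w (- x)) b - prim (\<lambda>x. w (- x)) a = (\<integral>r. indicator {a<..<b} r * w (- r) \<partial>lborel)"
      by (rule prim_diff[OF w' that])
    also have "\<dots> = (\<integral>r. indicator {- b<..< - a} r * w r \<partial>lborel)"
      by (subst lborel_integral_real_affine[of "-1" _ 0])
         (auto intro!: Bochner_Integration.integral_cong simp: indicator_def)
    also have "\<dots> = prim w (- a) - prim w (- b)"
      using that by (intro prim_diff[OF w, symmetric]) simp
    finally show ?thesis .
  qed
  have left: "AE x in lebesgue. \<forall>e>0. \<exists>d>0. \<forall>h. 0 < h \<and> h < d \<longrightarrow>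
      \<bar>(prim w x - prim w (x - h)) / h - w x\<bar> < e"
  proof -
    have "AE x in lborel. \<forall>e>0. \<exists>d>0. \<forall>h. 0 < h \<and> h < d \<longrightarrow>
        \<bar>(prim (\<lambda>x. w (- x)) (x + h) - prim (\<lambda>x. w (- x)) x) / h - w (- x)\<bar> < e"
      using integrable_average_tendsto_AE[OF w'] by (simp add: AE_completion_iff)
    \<comment> \<open>The exceptional set is made explicit because it has to be reflected, which
      keeps it null.\<close>
    then obtain N where N': "N \<in> null_sets lborel" and "\<And>x. x \<in> space lborel - N \<Longrightarrow> \<forall>e>0. \<exists>d>0. \<forall>h. 0 < h \<and> h < d \<longrightarrow>
        \<bar>(prim (\<lambda>x. w (- x)) (x + h) - prim (\<lambda>x. w (- x)) x) / h - w (- x)\<bar> < e"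
      by (rule AE_E3) (rule that)
    then have N: "\<exists>d>0. \<forall>h. 0 < h \<and> h < d \<longrightarrow>
        \<bar>(prim (\<lambda>x. w (- x)) (x + h) - prim (\<lambda>x. w (- x)) x) / h - w (- x)\<bar> < e" if "x \<notin> N" "e > 0" for x e
      using that by simp
    have "AE x in lborel. 0 + - 1 * x \<notin> N"
      by (rule AE_borel_affine) (use N' in \<open>auto intro: AE_not_in\<close>)
    then have "AE x in lebesgue. - x \<notin> N"
      by (simp add: AE_completion)
    then show ?thesis
    proof eventually_elim
      case (elim x)
      show ?case
      proof (intro allI impI)
        fix e :: real assume "e > 0"
        then obtain d where d: "d > 0" "\<And>h. 0 < h \<Longrightarrow> h < d \<Longrightarrow>
            \<bar>(prim (\<lambda>x. w (- x)) (- x + h) - prim (\<lambda>x. w (- x)) (- x)) / h - w (- (- x))\<bar> < e"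
          using N[OF elim] by blast
        have "\<bar>(prim w x - prim w (x - h)) / h - w x\<bar> < e" if "0 < h" "h < d" for h
          using d(2)[OF that] refl[of "- x" "- x + h"] that by simp
        then show "\<exists>d>0. \<forall>h. 0 < h \<and> h < d \<longrightarrow> \<bar>(prim w x - prim w (x - h)) / h - w x\<bar> < e"
          using d(1) by blast
      qed
    qed
  qed
  from integrable_average_tendsto_AE[OF w] left show ?thesis
  proof eventually_elim
    case (elim x)
    show ?case
      unfolding DERIV_def
    proof (rule LIM_I)
      fix e :: real assume "e > 0"
      from elim(1)[THEN spec, THEN mp, OF \<open>e > 0\<close>]
      obtain d1 where d1: "d1 > 0" "\<forall>h. 0 < h \<and> h < d1 \<longrightarrow> \<bar>(prim w (x + h) - prim w x) / h - w x\<bar> < e"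
        by (elim exE conjE)
      from elim(2)[THEN spec, THEN mp, OF \<open>e > 0\<close>]
      obtain d2 where d2: "d2 > 0" "\<forall>h. 0 < h \<and> h < d2 \<longrightarrow> \<bar>(prim w x - prim w (x - h)) / h - w x\<bar> < e"
        by (elim exE conjE)
      have "norm ((prim w (x + h) - prim w x) / h - w x) < e" if "h \<noteq> 0" "\<bar>h\<bar> < min d1 d2" for h
      proof (cases "h > 0")
        case True
        then show ?thesis
          using d1(2)[rule_format, of h] that by simp
      next
        case False
        have "(prim w (x + h) - prim w x) / h = (prim w x - prim w (x + h)) / (- h)"
          by (simp add: divide_simps)
        then show ?thesis
          using d2(2)[rule_format, of "- h"] that False by simp
      qed
      then show "\<exists>s>0. \<forall>h. h \<noteq> 0 \<and> norm (h - 0) < s \<longrightarrow>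
          norm ((prim w (x + h) - prim w x) / h - w x) < e"
        using d1(1) d2(1) by (intro exI[of _ "min d1 d2"]) auto
    qed
  qed
qed

text \<open>Here the derivative is needed at every point, since the primitive of a smooth function
  has to be smooth itself.\<close>

lemma prim_has_derivative:
  assumes w: "integrable lborel w" and cont: "continuous_on UNIV w"
  shows "(prim w has_real_derivative w x) (at x)"
proof -
  have "((\<lambda>y. integral {x - 1..y} w) has_real_derivative w x) (at x within {x - 1..x + 1})"
    by (rule integral_has_real_derivative) (use cont in \<open>auto intro: continuous_on_subset\<close>)
  then have "((\<lambda>y. integral {x - 1..y} w) has_real_derivative w x) (at x)"
    by (subst (asm) at_within_Icc_at) simp_all
  then have "((\<lambda>y. integral {x - 1..y} w + prim w (x - 1)) has_real_derivative w x + 0) (at x)"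
    by (intro DERIV_add DERIV_const)
  then have "(prim w has_real_derivative w x + 0) (at x)"
  proof (rule has_field_derivative_transform_within_open)
    show "integral {x - 1..y} w + prim w (x - 1) = prim w y" if "y \<in> {x - 1<..}" for y
      using that prim_diff_eq_integral[OF w, of "x - 1" y] by simp
  qed auto
  then show ?thesis
    by simp
qed

text \<open>Pointwise \<open>\<bar>w\<bar> \<le> N + u N\<close>, where \<open>u N\<close> is the
  part of \<open>\<bar>w\<bar>\<close> above the level \<open>N\<close>. By dominated convergence
  the integral of \<open>u N\<close> is below \<open>e / 2\<close> for some \<open>N\<close>; the
  bounded part contributes at most \<open>N\<close> times the total length.\<close>

lemma abs_cont_on_prim:
  assumes w: "integrable lborel w" and f: "\<And>t. t \<in> I \<Longrightarrow> f t = c + prim w t"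
  shows "abs_cont_on I f"
  unfolding abs_cont_on_def
proof (intro allI impI)
  fix e :: real assume "e > 0"
  note [measurable] = borel_measurable_integrable[OF w]
  define u where "u N x = (if real N < \<bar>w x\<bar> then \<bar>w x\<bar> else 0)" for N :: nat and x
  have u_meas [measurable]: "u N \<in> borel_measurable borel" for N
    unfolding u_def by measurable
  have u_int: "integrable lborel (u N)" for N
    by (rule Bochner_Integration.integrable_bound[OF w]) (auto simp: u_def intro!: AE_I2)
  have "(\<lambda>N. \<integral>x. u N x \<partial>lborel) \<longlonglongrightarrow> (\<integral>x. 0 \<partial>(lborel :: real measure))"
  proof (rule integral_dominated_convergence[where w = "\<lambda>x. \<bar>w x\<bar>"])
    have "(\<lambda>N. u N x) \<longlonglongrightarrow> 0" for x
    proof (rule tendsto_eventually)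
      obtain N0 :: nat where "\<bar>w x\<bar> \<le> real N0"
        using real_arch_simple by blast
      then have "\<forall>N\<ge>N0. u N x = 0"
        by (auto simp: u_def)
      then show "\<forall>\<^sub>F N in sequentially. u N x = 0"
        unfolding eventually_sequentially by blast
    qed
    then show "AE x in lborel. (\<lambda>N. u N x) \<longlonglongrightarrow> 0"
      by simp
  qed (use w in \<open>auto simp: u_def intro!: AE_I2\<close>)
  then have "\<forall>\<^sub>F N in sequentially. (\<integral>x. u N x \<partial>lborel) < e / 2"
    using \<open>e > 0\<close> by (intro order_tendstoD(2)) auto
  then obtain N where N: "(\<integral>x. u N x \<partial>lborel) < e / 2"
    using eventually_happens by (metis sequentially_bot)
  \<comment> \<open>Chosen to give \<open>N * d \<le> e / 2\<close>; the added \<open>1\<close>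
    keeps the denominator positive when \<open>N = 0\<close>.\<close>
  define d where "d = e / (2 * (real N + 1))"
  show "\<exists>d>0. \<forall>(n::nat) a b. (\<forall>i<n. a i \<in> I \<and> b i \<in> I \<and> a i \<le> b i) \<and>
      disjoint_family_on (\<lambda>i. {a i<..<b i}) {..<n} \<and> (\<Sum>i<n. b i - a i) < d \<longrightarrow>
      (\<Sum>i<n. \<bar>f (b i) - f (a i)\<bar>) < e"
  proof (intro exI[of _ d] conjI allI impI)
    show "d > 0"
      using \<open>e > 0\<close> by (simp add: d_def)
    fix n :: nat and a b
    assume *: "(\<forall>i<n. a i \<in> I \<and> b i \<in> I \<and> a i \<le> b i) \<and>
      disjoint_family_on (\<lambda>i. {a i<..<b i}) {..<n} \<and> (\<Sum>i<n. b i - a i) < d"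
    have int: "integrable lborel (\<lambda>x. indicator A x * g x)" if "A \<in> sets borel" "integrable lborel g"
      for A and g :: "real \<Rightarrow> real"
      using integrable_mult_indicator[OF _ that(2), of A] that by simp
    have le: "\<bar>f (b i) - f (a i)\<bar> \<le> real N * (b i - a i) + (\<integral>x. indicator {a i<..<b i} x * u N x \<partial>lborel)"
      if "i < n" for i
    proof -
      have ab: "a i \<le> b i" "f (b i) - f (a i) = (\<integral>x. indicator {a i<..<b i} x * w x \<partial>lborel)"
        using * that prim_diff[OF w, of "a i" "b i"] by (auto simp: f)
      have i1: "integrable lborel (\<lambda>x. real N * indicator {a i<..<b i} x)"
        using ab(1) by simp
      have "\<bar>f (b i) - f (a i)\<bar> \<le> (\<integral>x. \<bar>indicator {a i<..<b i} x * w x\<bar> \<partial>lborel)"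
        unfolding ab(2) by (rule integral_abs_bound)
      also have "\<dots> \<le> (\<integral>x. real N * indicator {a i<..<b i} x + indicator {a i<..<b i} x * u N x \<partial>lborel)"
        by (rule integral_mono[OF integrable_abs[OF int[OF _ w]] Bochner_Integration.integrable_add[OF i1 int[OF _ u_int]]])
           (auto simp: u_def indicator_def)
      also have "\<dots> = real N * (b i - a i) + (\<integral>x. indicator {a i<..<b i} x * u N x \<partial>lborel)"
        using ab(1) by (subst Bochner_Integration.integral_add[OF i1 int[OF _ u_int]]) simp_all
      finally show ?thesis .
    qed
    have "(\<Sum>i<n. \<bar>f (b i) - f (a i)\<bar>) \<le>
        (\<Sum>i<n. real N * (b i - a i) + (\<integral>x. indicator {a i<..<b i} x * u N x \<partial>lborel))"
      by (rule sum_mono) (use le in auto)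
    also have "\<dots> = real N * (\<Sum>i<n. b i - a i) + (\<integral>x. (\<Sum>i<n. indicator {a i<..<b i} x * u N x) \<partial>lborel)"
      by (subst Bochner_Integration.integral_sum) (auto intro!: int u_int simp: sum.distrib sum_distrib_left)
    also have "(\<integral>x. (\<Sum>i<n. indicator {a i<..<b i} x * u N x) \<partial>lborel) \<le> (\<integral>x. u N x \<partial>lborel)"
    proof (rule integral_mono[OF _ u_int])
      show "integrable lborel (\<lambda>x. \<Sum>i<n. indicator {a i<..<b i} x * u N x)"
        by (intro Bochner_Integration.integrable_sum int u_int) auto
      fix x
      \<comment> \<open>Disjointness enters here: the indicators add up to a single indicator, so
        the number of intervals does not matter.\<close>
      have "(\<Sum>i<n. indicator {a i<..<b i} x * u N x) = indicator (\<Union>i<n. {a i<..<b i}) x * u N x"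
        using * by (subst indicator_UN_disjoint) (auto simp: sum_distrib_right)
      also have "\<dots> \<le> u N x"
        by (auto simp: indicator_def u_def)
      finally show "(\<Sum>i<n. indicator {a i<..<b i} x * u N x) \<le> u N x" .
    qed
    also have "real N * (\<Sum>i<n. b i - a i) \<le> real N * d"
      using * by (intro mult_left_mono) auto
    also have "real N * d \<le> e / 2"
      using \<open>e > 0\<close> by (simp add: d_def field_simps)
    finally show "(\<Sum>i<n. \<bar>f (b i) - f (a i)\<bar>) < e"
      using N by simp
  qed
qed

subsection \<open>The lemma of du Bois-Reymond\<close>

text \<open>The arguments are \<open>n * (x - p)\<close> and \<open>n * (q - x)\<close>, expanded to
  fit \<open>smooth_affine\<close>. The scale \<open>n\<close> steepens the flanks: for
  \<open>y > 0\<close>, \<open>exp (- 1 / (n * y))\<close> tends to \<open>1\<close>, so the bumps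
  tend to the indicator of the open interval.\<close>

definition bump :: "real \<Rightarrow> real \<Rightarrow> real \<Rightarrow> real \<Rightarrow> real" where
  "bump p q n x = flat_exp 0 (n * x + - n * p) * flat_exp 0 (- n * x + n * q)"

lemma smooth_bump: "smooth (bump p q n)"
  unfolding bump_def by (intro smooth_mult smooth_affine smooth_flat_exp)

lemma flat_exp_0_bounds: "0 \<le> flat_exp 0 x" "flat_exp 0 x \<le> 1"
  by (auto simp: flat_exp_def)

lemma bump_bounds: "0 \<le> bump p q n x" "bump p q n x \<le> 1"
  unfolding bump_def by (auto intro!: mult_nonneg_nonneg mult_le_one flat_exp_0_bounds)

lemma bump_eq_0:
  assumes "n > 0" "x \<notin> {p..q}"
  shows "bump p q n x = 0"
proof -
  have "n * x + - n * p = n * (x - p)" "- n * x + n * q = n * (q - x)"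
    by (simp_all add: algebra_simps)
  moreover have "\<not> 0 < n * (x - p) \<or> \<not> 0 < n * (q - x)"
    using assms by (auto simp: zero_less_mult_iff)
  ultimately show ?thesis
    by (auto simp: bump_def flat_exp_def)
qed

lemma bump_pos: "n > 0 \<Longrightarrow> p < x \<Longrightarrow> x < q \<Longrightarrow> bump p q n x > 0"
  by (auto simp: bump_def flat_exp_def intro!: mult_pos_pos)

lemma bump_tendsto_indicator: "(\<lambda>n. bump p q (real (Suc n)) x) \<longlonglongrightarrow> indicator {p<..<q} x"
proof -
  have lim: "(\<lambda>n. flat_exp 0 (real (Suc n) * y)) \<longlonglongrightarrow> indicator {0<..} y" for y
  proof (cases "y > 0")
    case True
    have "(\<lambda>n. exp (- (inverse (real (Suc n)) * inverse y))) \<longlonglongrightarrow> exp (- (0 * inverse y))"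
      by (intro tendsto_intros LIMSEQ_inverse_real_of_nat)
    then show ?thesis
      using True by (simp add: flat_exp_def zero_less_mult_iff)
  next
    case False
    then show ?thesis
      by (simp add: flat_exp_def zero_less_mult_iff)
  qed
  have "bump p q (real (Suc n)) x = flat_exp 0 (real (Suc n) * (x - p)) * flat_exp 0 (real (Suc n) * (q - x))" for n
    unfolding bump_def by (intro arg_cong2[where f = "(*)"] arg_cong[where f = "flat_exp 0"]) (simp_all add: algebra_simps)
  then have "(\<lambda>n. bump p q (real (Suc n)) x) \<longlonglongrightarrow> indicator {0<..} (x - p) * indicator {0<..} (q - x)"
    using tendsto_mult[OF lim lim] by simp
  also have "indicator {0<..} (x - p) * indicator {0<..} (q - x) = (indicator {p<..<q} x :: real)"
    by (auto simp: indicator_def)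
  finally show ?thesis .
qed

lemma bump_test_fun: "n > 0 \<Longrightarrow> {p..q} \<subseteq> U \<Longrightarrow> bump p q n \<in> test_fun U"
  by (rule test_funI[OF smooth_bump bump_eq_0])

text \<open>The bumps converge boundedly to indicators, so \<open>w\<close> has integral zero over
  each interval inside \<open>(a,b)\<close>. Hence \<open>prim w\<close> is constant there, and its
  derivative is \<open>w\<close> almost everywhere.\<close>

lemma fundamental_lemma:
  assumes w: "integrable lborel w"
    and orth: "\<And>f. f \<in> test_fun {a<..<b} \<Longrightarrow> (\<integral>x. w x * f x \<partial>lborel) = 0"
  shows "AE x in lebesgue. a < x \<and> x < b \<longrightarrow> w x = 0"
proof -
  note [measurable] = borel_measurable_integrable[OF w] smooth_borel_measurable[OF smooth_bump]
  have zero: "(\<integral>x. indicator {p<..<q} x * w x \<partial>lborel) = 0" if "a < p" "q < b" for p q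
  proof -
    have "(\<lambda>n. \<integral>x. bump p q (real (Suc n)) x * w x \<partial>lborel) \<longlonglongrightarrow> (\<integral>x. indicator {p<..<q} x * w x \<partial>lborel)"
    proof (rule integral_dominated_convergence[where w = "\<lambda>x. \<bar>w x\<bar>"])
      show "AE x in lborel. (\<lambda>n. bump p q (real (Suc n)) x * w x) \<longlonglongrightarrow> indicator {p<..<q} x * w x"
        by (intro AE_I2 tendsto_mult tendsto_const bump_tendsto_indicator)
      show "AE x in lborel. norm (bump p q (real (Suc n)) x * w x) \<le> \<bar>w x\<bar>" for n
        using bump_bounds[of p q "real (Suc n)"]
        by (intro AE_I2) (simp add: abs_mult mult_left_le_one_le)
    qed (use w in simp_all)
    moreover have "(\<integral>x. bump p q (real (Suc n)) x * w x \<partial>lborel) = 0" for n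
    proof -
      have "bump p q (real (Suc n)) \<in> test_fun {a<..<b}"
        using that by (intro bump_test_fun) auto
      from orth[OF this] show ?thesis
        by (simp add: mult.commute)
    qed
    ultimately show ?thesis
      using LIMSEQ_unique[OF _ tendsto_const] by simp
  qed
  have const: "prim w q = prim w p" if "a < p" "q < b" "p \<le> q" for p q
    using prim_diff[OF w that(3)] zero[OF that(1,2)] by simp
  have eq: "prim w x = prim w y" if "x \<in> {a<..<b}" "y \<in> {a<..<b}" for x y
    using that const[of x y] const[of y x] by (cases "x \<le> y") auto
  have deriv_0: "(prim w has_real_derivative 0) (at x)" if x: "x \<in> {a<..<b}" for x
    by (rule has_field_derivative_transform_within_open[OF DERIV_const open_greaterThanLessThan x]) (rule eq[OF x])
  from prim_has_derivative_AE[OF w] show ?thesis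
  proof eventually_elim
    case (elim x)
    show ?case
    proof
      assume "a < x \<and> x < b"
      then show "w x = 0"
        using DERIV_unique[OF elim deriv_0[of x]] by simp
    qed
  qed
qed

lemma test_fun_supportE:
  assumes "f \<in> test_fun {a<..<b}" "a < b"
  obtains p q where "a < p" "p < q" "q < b" "\<And>x. x \<notin> {p..q} \<Longrightarrow> f x = 0"
proof -
  obtain K where K: "compact K" "K \<subseteq> {a<..<b}" "\<And>x. x \<notin> K \<Longrightarrow> f x = 0"
    using assms(1) by (rule test_funE) blast
  \<comment> \<open>The midpoint is added to \<open>K\<close> so that extrema exist even for an
    empty support.\<close>
  define m where "m = (a + b) / 2"
  have ne: "compact (insert m K)" "insert m K \<noteq> {}" "insert m K \<subseteq> {a<..<b}"
    using K(1,2) assms(2) by (auto simp: m_def)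
  obtain l where l: "l \<in> insert m K" "\<And>x. x \<in> insert m K \<Longrightarrow> l \<le> x"
    using compact_attains_inf[OF ne(1,2)] by blast
  obtain u where u: "u \<in> insert m K" "\<And>x. x \<in> insert m K \<Longrightarrow> x \<le> u"
    using compact_attains_sup[OF ne(1,2)] by blast
  have "l \<in> {a<..<b}" "u \<in> {a<..<b}"
    using l(1) u(1) ne(3) by blast+
  \<comment> \<open>Enlarging \<open>u\<close> to \<open>(u + b) / 2\<close> makes the interval
    nondegenerate even if \<open>l = u\<close>.\<close>
  moreover have "f x = 0" if "x \<notin> {l..(u + b) / 2}" for x
  proof (rule K(3), rule notI)
    assume "x \<in> K"
    then show False
      using that l(2)[of x] u(2)[of x] \<open>u \<in> {a<..<b}\<close> by auto
  qed
  ultimately show ?thesis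
    using that[of l "(u + b) / 2"] l(2)[OF u(1)] by auto
qed

text \<open>Only derivatives of test functions are available, and these have integral zero.
  Subtracting from \<open>f\<close> the multiple \<open>J / I\<close> of a fixed bump makes its
  integral zero, so that the primitive is a test function; the hypothesis for it says that
  \<open>u - c\<close> is orthogonal to \<open>f\<close>.\<close>

lemma du_Bois_Reymond:
  assumes u: "integrable lborel u" and ab: "a < b"
    and orth: "\<And>f. f \<in> test_fun {a<..<b} \<Longrightarrow> (\<integral>x. u x * deriv f x \<partial>lborel) = 0"
  shows "\<exists>c. AE x in lebesgue. a < x \<and> x < b \<longrightarrow> u x = c"
proof -
  define m where "m = (\<lambda>i::nat. a + real i * (b - a) / 3)"
  have m: "a < m 1" "m 1 < m 2" "m 2 < b"
    using ab by (auto simp: m_def field_simps)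
  define \<chi>0 where "\<chi>0 = bump (m 1) (m 2) 1"
  have \<chi>0: "\<chi>0 \<in> test_fun {a<..<b}"
    unfolding \<chi>0_def using m by (intro bump_test_fun) auto
  have test: "integrable lborel f" "\<exists>C. \<forall>x. \<bar>f x\<bar> \<le> C" "f \<in> borel_measurable borel"
    if f: "f \<in> test_fun {a<..<b}" for f
  proof -
    obtain K where K: "compact K" "\<And>x. x \<notin> K \<Longrightarrow> f x = 0"
      using f by (rule test_funE) blast
    show "integrable lborel f" "\<exists>C. \<forall>x. \<bar>f x\<bar> \<le> C"
      using continuous_compact_support[OF smooth_continuous_on[OF test_fun_smooth[OF f]] K] by auto
    show "f \<in> borel_measurable borel"
      by (rule smooth_borel_measurable[OF test_fun_smooth[OF f]])
  qed
  have u_test: "integrable lborel (\<lambda>x. u x * f x)" if f: "f \<in> test_fun {a<..<b}" for f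
  proof -
    note [measurable] = borel_measurable_integrable[OF u] test(3)[OF f]
    obtain C where C: "\<And>x. \<bar>f x\<bar> \<le> C"
      using test(2)[OF f] by blast
    have "integrable lborel (\<lambda>x. C * u x)"
      using u by simp
    then show ?thesis
    proof (rule Bochner_Integration.integrable_bound)
      show "AE x in lborel. norm (u x * f x) \<le> norm (C * u x)"
      proof (rule AE_I2)
        fix x
        have "0 \<le> C"
          using C[of 0] by linarith
        then show "norm (u x * f x) \<le> norm (C * u x)"
          using mult_left_mono[OF C[of x], of "\<bar>u x\<bar>"] by (simp add: abs_mult mult.commute)
      qed
    qed measurable
  qed
  \<comment> \<open>A nonnegative function with integral zero vanishes almost everywhere, a
    continuous one even everywhere; the bump is positive at its centre.\<close>
  have "(\<integral>x. \<chi>0 x \<partial>lborel) \<noteq> 0"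
  proof
    assume "(\<integral>x. \<chi>0 x \<partial>lborel) = 0"
    then have "AE x in lborel. \<chi>0 x = 0"
      using integral_nonneg_eq_0_iff_AE[OF test(1)[OF \<chi>0]] bump_bounds(1) by (simp add: \<chi>0_def)
    then have "AE x in lebesgue. x \<in> {x. \<chi>0 x = 0}"
      by (simp add: AE_completion)
    moreover have "closed {x. \<chi>0 x = 0}"
      using smooth_continuous_on[OF smooth_bump] unfolding \<chi>0_def
      by (intro closed_Collect_eq continuous_on_const) auto
    ultimately have "(m 1 + m 2) / 2 \<in> {x. \<chi>0 x = 0}"
      by (intro mem_closed_if_AE_lebesgue)
    then show False
      using bump_pos[of 1 "m 1" "(m 1 + m 2) / 2" "m 2"] m by (simp add: \<chi>0_def)
  qed
  define I where "I = (\<integral>x. \<chi>0 x \<partial>lborel)"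
  \<comment> \<open>The value is forced: if \<open>u\<close> is a constant, its pairing with the
    bump is that constant times \<open>I\<close>.\<close>
  define c where "c = (\<integral>x. u x * \<chi>0 x \<partial>lborel) / I"
  have "I \<noteq> 0"
    using \<open>(\<integral>x. \<chi>0 x \<partial>lborel) \<noteq> 0\<close> by (simp add: I_def)
  define w where "w = (\<lambda>x. indicator {a<..<b} x * (u x - c))"
  have ind: "integrable lborel (\<lambda>x. c * indicator {a<..<b} x)"
    using ab by simp
  have "integrable lborel (\<lambda>x. indicator {a<..<b} x *\<^sub>R u x - c * indicator {a<..<b} x)"
    using u ind by (intro Bochner_Integration.integrable_diff integrable_mult_indicator) auto
  then have w: "integrable lborel w"
    by (simp add: w_def algebra_simps)
  have "(\<integral>x. w x * f x \<partial>lborel) = 0" if f: "f \<in> test_fun {a<..<b}" for f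
  proof -
    define J where "J = (\<integral>x. f x \<partial>lborel)"
    define g where "g = (\<lambda>x. f x + (- J / I) * \<chi>0 x)"
    obtain p q where pq: "a < p" "p < q" "q < b" "\<And>x. x \<notin> {p..q} \<Longrightarrow> f x = 0"
      using f ab by (rule test_fun_supportE) blast
    obtain p' q' where pq': "a < p'" "p' < q'" "q' < b" "\<And>x. x \<notin> {p'..q'} \<Longrightarrow> \<chi>0 x = 0"
      using \<chi>0 ab by (rule test_fun_supportE) blast
    define l h where "l = min p p'" and "h = max q q'"
    have g0: "g x = 0" if "x \<notin> {l..h}" for x
    proof -
      have "x \<notin> {p..q}" "x \<notin> {p'..q'}"
        using that by (auto simp: l_def h_def)
      then show ?thesis
        by (simp add: g_def pq(4) pq'(4))
    qed
    have g: "smooth g"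
      unfolding g_def by (intro smooth_add smooth_cmult test_fun_smooth[OF f] test_fun_smooth[OF \<chi>0])
    have g_int: "integrable lborel g"
      unfolding g_def by (intro Bochner_Integration.integrable_add integrable_mult_right test(1) f \<chi>0)
    have "integrable lborel (\<lambda>x. (- J / I) * \<chi>0 x)"
      by (intro integrable_mult_right test(1) \<chi>0)
    from Bochner_Integration.integral_add[OF test(1)[OF f] this]
    have "(\<integral>x. g x \<partial>lborel) = J + (- J / I) * I"
      by (simp add: g_def J_def I_def)
    then have g_total: "(\<integral>x. g x \<partial>lborel) = 0"
      using \<open>I \<noteq> 0\<close> by simp
    have deriv: "(prim g has_real_derivative g x) (at x)" for x
      by (rule prim_has_derivative[OF g_int smooth_continuous_on[OF g]])
    have "prim g \<in> test_fun {a<..<b}"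
    proof (rule test_funI[of _ "l" "h"])
      show "smooth (prim g)"
        by (rule smooth_antideriv[OF deriv g])
      show "prim g x = 0" if "x \<notin> {l..h}" for x
      proof (cases "x < l")
        case True
        then have "indicator {..<x} r * g r = 0" for r
          using g0[of r] by (auto simp: indicator_def)
        then show ?thesis
          by (simp only: prim_def) simp
      next
        case False
        \<comment> \<open>Right of \<open>h\<close> the primitive equals the total integral of
          \<open>g\<close>, which the subtracted bump has made zero.\<close>
        then have "indicator {..<x} r * g r = g r" for r
          using g0[of r] that by (auto simp: indicator_def)
        then show ?thesis
          using g_total by (simp only: prim_def)
      qed
      show "{l..h} \<subseteq> {a<..<b}"
        using pq pq' by (auto simp: l_def h_def)
    qed
    from orth[OF this] have "(\<integral>x. u x * g x \<partial>lborel) = 0"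
      using DERIV_imp_deriv[OF deriv] by simp
    also have "(\<lambda>x. u x * g x) = (\<lambda>x. u x * f x + (- J / I) * (u x * \<chi>0 x))"
      by (auto simp: g_def algebra_simps)
    also have "(\<integral>x. u x * f x + (- J / I) * (u x * \<chi>0 x) \<partial>lborel) = (\<integral>x. u x * f x \<partial>lborel) - c * J"
    proof -
      have "integrable lborel (\<lambda>x. (- J / I) * (u x * \<chi>0 x))"
        by (intro integrable_mult_right u_test \<chi>0)
      from Bochner_Integration.integral_add[OF u_test[OF f] this] show ?thesis
        by (simp add: c_def)
    qed
    finally have uf: "(\<integral>x. u x * f x \<partial>lborel) = c * J"
      by simp
    have "w x * f x = u x * f x - c * f x" for x
      using pq(1,3) pq(4)[of x] by (auto simp: w_def indicator_def algebra_simps)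
    then have "(\<integral>x. w x * f x \<partial>lborel) = (\<integral>x. u x * f x - c * f x \<partial>lborel)"
      by simp
    also have "\<dots> = 0"
      using u_test[OF f] test(1)[OF f] uf by (subst Bochner_Integration.integral_diff) (auto simp: J_def)
    finally show ?thesis .
  qed
  then have "AE x in lebesgue. a < x \<and> x < b \<longrightarrow> w x = 0"
    by (rule fundamental_lemma[OF w])
  then show ?thesis
    by (intro exI[of _ c]) (auto elim!: eventually_mono simp: w_def)
qed

subsection \<open>Functions in the space X\<close>

text \<open>The case \<open>n = 1\<close> of the definition; through it \<open>prim w\<close>
  inherits continuity.\<close>

lemma abs_cont_on_imp_uniformly_continuous_on:
  assumes "abs_cont_on I f"
  shows "uniformly_continuous_on I f"
  unfolding uniformly_continuous_on_def
proof (intro allI impI)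
  fix e :: real assume "e > 0"
  let ?Q = "\<lambda>d. \<forall>(n::nat) a b. (\<forall>i<n. a i \<in> I \<and> b i \<in> I \<and> a i \<le> b i) \<and>
      disjoint_family_on (\<lambda>i. {a i<..<b i}) {..<n} \<and> (\<Sum>i<n. b i - a i) < d \<longrightarrow>
      (\<Sum>i<n. \<bar>f (b i) - f (a i)\<bar>) < e"
  obtain d where d: "d > 0" "?Q d"
    using assms[unfolded abs_cont_on_def, THEN spec, THEN mp, OF \<open>e > 0\<close>] by (elim exE conjE)
  have *: "\<bar>f q - f p\<bar> < e" if "p \<in> I" "q \<in> I" "p \<le> q" "q - p < d" for p q
    using d(2)[THEN spec[of _ 1], THEN spec[of _ "\<lambda>_. p"], THEN spec[of _ "\<lambda>_. q"]] that
    by (simp add: disjoint_family_on_def)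
  have "dist (f y) (f x) < e" if "x \<in> I" "y \<in> I" "dist y x < d" for x y
  proof (cases "x \<le> y")
    case True
    then show ?thesis
      using *[of x y] that by (simp add: dist_real_def)
  next
    case False
    then show ?thesis
      using *[of y x] that by (simp add: dist_real_def abs_minus_commute)
  qed
  with d(1) show "\<exists>d>0. \<forall>x\<in>I. \<forall>y\<in>I. dist y x < d \<longrightarrow> dist (f y) (f x) < e"
    by blast
qed

lemma continuous_prim: "integrable lborel w \<Longrightarrow> continuous_on UNIV (prim w)"
  by (intro uniformly_continuous_imp_continuous abs_cont_on_imp_uniformly_continuous_on
      abs_cont_on_prim[of w _ _ 0]) simp_all

lemma borel_measurable_prim: "integrable lborel w \<Longrightarrow> prim w \<in> borel_measurable borel"
  by (intro borel_measurable_continuous_onI continuous_prim)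

section \<open>Localization below \<open>T\<close> and passage to Borel representatives\<close>

lemma compact_below_ereal:
  assumes "compact K" "K \<subseteq> {t. ereal t < T}" "0 < T"
  obtains M where "0 < M" "ereal M < T" "K \<subseteq> {..<M}"
proof -
  \<comment> \<open>Adding \<open>0\<close> covers an empty \<open>K\<close> and forces the bound
    \<open>M\<close> to be positive.\<close>
  have ne: "compact (insert 0 K)" "insert 0 K \<noteq> {}"
    using assms(1) by auto
  obtain u where u: "u \<in> insert 0 K" "\<And>x. x \<in> insert 0 K \<Longrightarrow> x \<le> u"
    using compact_attains_sup[OF ne] by blast
  have "ereal u < T"
    using u(1) assms(2,3) by (auto simp: zero_ereal_def)
  then obtain M where M: "u < M" "ereal M < T"
    using ereal_dense2[OF \<open>ereal u < T\<close>] by auto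
  have "0 < M" "K \<subseteq> {..<M}"
    using M(1) u(2)[of 0] le_less_trans[OF u(2) M(1)] by auto
  with M(2) show ?thesis
    by (intro that)
qed

text \<open>Rational bounds suffice by density, and only countably many exceptional sets can be
  united.\<close>

lemma AE_below_ereal:
  assumes "\<And>M. 0 < M \<Longrightarrow> ereal M < T \<Longrightarrow> AE t in lebesgue. 0 < t \<and> t < M \<longrightarrow> P t"
  shows "AE t in lebesgue. 0 < t \<and> ereal t < T \<longrightarrow> P t"
proof -
  have "AE t in lebesgue. \<forall>q::rat. 0 < real_of_rat q \<and> ereal (real_of_rat q) < T \<longrightarrow> 0 < t \<and> t < real_of_rat q \<longrightarrow> P t"
    unfolding AE_all_countable
  proof
    fix q :: rat
    show "AE t in lebesgue. 0 < real_of_rat q \<and> ereal (real_of_rat q) < T \<longrightarrow> 0 < t \<and> t < real_of_rat q \<longrightarrow> P t"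
    proof (cases "0 < real_of_rat q \<and> ereal (real_of_rat q) < T")
      case True
      with assms[of "real_of_rat q"] show ?thesis
        by simp
    next
      case False
      then show ?thesis
        by (intro AE_I2) blast
    qed
  qed
  then show ?thesis
  proof (eventually_elim, intro impI)
    fix t
    assume *: "\<forall>q::rat. 0 < real_of_rat q \<and> ereal (real_of_rat q) < T \<longrightarrow> 0 < t \<and> t < real_of_rat q \<longrightarrow> P t"
      and t: "0 < t \<and> ereal t < T"
    then obtain q :: rat where q: "ereal t < real_of_rat q" "real_of_rat q < T"
      using ereal_dense3 by blast
    have "t < real_of_rat q"
      using q(1) by simp
    moreover from this have "0 < real_of_rat q"
      using t by linarith
    ultimately show "P t"
      using *[THEN spec, of q] q(2) t by blast
  qed
qed

text \<open>Since the test function vanishes off \<open>K\<close>, the representative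
  \<open>g'\<close> has to match \<open>g\<close> only there. This is what permits cut-off
  functions.\<close>

lemma reg_distr_eq_integral:
  assumes K: "K \<subseteq> U" "\<And>x. x \<notin> K \<Longrightarrow> f x = 0"
    and f: "f \<in> borel_measurable borel" and g': "g' \<in> borel_measurable borel"
    and g: "AE t in lebesgue. t \<in> K \<longrightarrow> g t = g' t"
  shows "reg_distr U g f = (\<integral>t. g' t * f t \<partial>lborel)"
  unfolding reg_distr_def set_lebesgue_integral_def
proof (rule integral_lebesgue_AE)
  show "AE t in lebesgue. indicator U t *\<^sub>R (g t * f t) = g' t * f t"
    using g by eventually_elim (use K in \<open>auto simp: indicator_def\<close>)
qed (use f g' in measurable)

section \<open>Local representation of functions in \<open>X_space\<close> and the value at
  \<open>0+\<close>\<close>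

lemma X_space_representation:
  assumes \<phi>: "\<phi> \<in> X_space T" and M: "0 < M" "ereal M < T"
    and deriv: "distr_integrable_on {0<..<M} (distr_deriv (reg_distr {t. 0 < t \<and> ereal t < T} \<phi>))"
  obtains w c where "integrable lborel w" "\<And>r. r \<notin> {0<..<M} \<Longrightarrow> w r = 0"
    "AE t in lebesgue. 0 < t \<and> t < M \<longrightarrow> \<phi> t = c + prim w t"
proof -
  let ?U = "{t. 0 < t \<and> ereal t < T}"
  have less: "ereal t < T" if "t \<le> M" for t
    using that M(2) by (meson ereal_less_eq(3) le_less_trans)
  have sub: "{0<..<M} \<subseteq> ?U" "{0..M} \<subseteq> {t. 0 \<le> t \<and> ereal t < T}"
    using less by auto
  have "set_integrable lebesgue {0..M} \<phi>"
    using \<phi> sub(2) by (auto simp: X_space_def L1loc_def)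
  then obtain u0 where u0: "integrable lborel u0" "AE t in lebesgue. indicator {0..M} t *\<^sub>R \<phi> t = u0 t"
    unfolding set_integrable_def by (rule integrable_lebesgue_imp_lborel)
  obtain v where v: "set_integrable lebesgue {0<..<M} v"
    "\<And>f. f \<in> test_fun {0<..<M} \<Longrightarrow> distr_deriv (reg_distr ?U \<phi>) f = reg_distr {0<..<M} v f"
    using deriv unfolding distr_integrable_on_def distr_eq_def by blast
  obtain v0 where v0: "integrable lborel v0" "AE t in lebesgue. indicator {0<..<M} t *\<^sub>R v t = v0 t"
    using v(1) unfolding set_integrable_def by (rule integrable_lebesgue_imp_lborel)
  \<comment> \<open>\<open>v0\<close> vanishes off \<open>(0,M)\<close> only almost everywhere; the
    indicator makes this hold at every point.\<close>
  define w where "w = (\<lambda>r. indicator {0<..<M} r *\<^sub>R v0 r)"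
  have w: "integrable lborel w"
    unfolding w_def by (intro integrable_mult_indicator v0) auto
  define u where "u = (\<lambda>t. indicator {0<..<M} t *\<^sub>R u0 t - prim w t * indicator {0<..<M} t)"
  have "integrable lborel (indicator {0<..<M} :: real \<Rightarrow> real)"
    using M(1) by simp
  then have u: "integrable lborel u"
    unfolding u_def
    by (intro Bochner_Integration.integrable_diff integrable_mult_indicator integrable_prim_mult w u0) auto
  have "(\<integral>x. u x * deriv f x \<partial>lborel) = 0" if f: "f \<in> test_fun {0<..<M}" for f
  proof -
    obtain K where K: "compact K" "K \<subseteq> {0<..<M}" "\<And>x. x \<notin> K \<Longrightarrow> f x = 0" "\<And>x. x \<notin> K \<Longrightarrow> deriv f x = 0"
      using f by (rule test_funE) blast
    note sm = test_fun_smooth[OF f]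
    note [measurable] = smooth_borel_measurable[OF sm] smooth_borel_measurable[OF smooth_deriv[OF sm]]
      borel_measurable_integrable[OF u0(1)] borel_measurable_integrable[OF w] borel_measurable_prim[OF w]
    have "reg_distr ?U \<phi> (deriv f) = (\<integral>t. u0 t * deriv f t \<partial>lborel)"
    proof (rule reg_distr_eq_integral[of K])
      show "AE t in lebesgue. t \<in> K \<longrightarrow> \<phi> t = u0 t"
        using u0(2) by eventually_elim (use K(2) in auto)
    qed (use K sub(1) in auto)
    moreover have "reg_distr {0<..<M} v f = (\<integral>t. w t * f t \<partial>lborel)"
    proof (rule reg_distr_eq_integral[of K])
      show "AE t in lebesgue. t \<in> K \<longrightarrow> v t = w t"
        using v0(2) by eventually_elim (use K(2) in \<open>auto simp: w_def\<close>)
    qed (use K in auto)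
    moreover have "(\<integral>s. prim w s * deriv f s \<partial>lborel) = - (\<integral>r. w r * f r \<partial>lborel)"
      by (rule integral_prim_mult_deriv[OF w sm K(1,3,4)])
    \<comment> \<open>Both integrals equal minus the pairing of \<open>w\<close> with
      \<open>f\<close>: one by hypothesis, the other by parts.\<close>
    ultimately have eq: "(\<integral>t. u0 t * deriv f t \<partial>lborel) = (\<integral>s. prim w s * deriv f s \<partial>lborel)"
      using v(2)[OF f] by (simp add: distr_deriv_def)
    have f': "integrable lborel (deriv f)" "\<exists>C. \<forall>x. \<bar>deriv f x\<bar> \<le> C"
      using continuous_compact_support[OF smooth_continuous_on[OF smooth_deriv[OF sm]] K(1,4)] by auto
    then obtain C where C: "\<And>x. \<bar>deriv f x\<bar> \<le> C"
      by blast
    have i1: "integrable lborel (\<lambda>t. u0 t * deriv f t)"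
    proof (rule Bochner_Integration.integrable_bound)
      show "integrable lborel (\<lambda>t. C * u0 t)"
        using u0(1) by simp
      have "norm (u0 t * deriv f t) \<le> norm (C * u0 t)" for t
        using mult_left_mono[OF order_trans[OF C abs_ge_self], of "\<bar>u0 t\<bar>"] by (simp add: abs_mult mult.commute)
      then show "AE t in lborel. norm (u0 t * deriv f t) \<le> norm (C * u0 t)"
        by simp
    qed measurable
    have "u t * deriv f t = u0 t * deriv f t - prim w t * deriv f t" for t
      using K(2) K(4)[of t] by (cases "t \<in> K") (auto simp: u_def indicator_def algebra_simps)
    then show ?thesis
      using Bochner_Integration.integral_diff[OF i1 integrable_prim_mult[OF w f'(1)]] eq by simp
  qed
  then obtain c where c: "AE t in lebesgue. 0 < t \<and> t < M \<longrightarrow> u t = c"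
    using du_Bois_Reymond[OF u M(1)] by blast
  show ?thesis
  proof (rule that[OF w])
    show "w r = 0" if "r \<notin> {0<..<M}" for r
      using that by (simp add: w_def)
    show "AE t in lebesgue. 0 < t \<and> t < M \<longrightarrow> \<phi> t = c + prim w t"
      using c u0(2) by eventually_elim (auto simp: u_def)
  qed
qed

text \<open>The integrand differs from \<open>\<bar>c - d\<bar>\<close> by at most
  \<open>\<bar>prim w s\<bar>\<close>, which is small near \<open>0\<close>. The value
  \<open>d\<close> is kept general because \<open>d = c\<close> yields existence of the right value,
  while the limit at any other \<open>d\<close> yields uniqueness.\<close>

lemma average_tendsto_initial_value:
  assumes w: "integrable lborel w" "\<And>r. r \<le> 0 \<Longrightarrow> w r = 0" and M: "0 < M"
    and \<phi>: "AE t in lebesgue. 0 < t \<and> t < M \<longrightarrow> \<phi> t = c + prim w t"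
  shows "((\<lambda>t. 1 / t * (LINT s:{0<..<t}|lebesgue. \<bar>\<phi> s - d\<bar>)) \<longlongrightarrow> \<bar>c - d\<bar>) (at_right 0)"
proof (rule tendstoI)
  fix e :: real assume "e > 0"
  note [measurable] = borel_measurable_prim[OF w(1)]
  have "(prim w \<longlongrightarrow> prim w 0) (at_right 0)"
    using continuous_prim[OF w(1)] by (simp add: continuous_on_eq_continuous_at isCont_def filterlim_at_split)
  moreover have "prim w 0 = 0"
    by (rule prim_eq_0[OF w(2)]) auto
  ultimately have "\<forall>\<^sub>F t in at_right 0. dist (prim w t) 0 < e / 2"
    using \<open>e > 0\<close> by (intro tendstoD) auto
  then obtain \<delta> where \<delta>: "\<delta> > 0" "\<And>t. 0 < t \<Longrightarrow> t < \<delta> \<Longrightarrow> \<bar>prim w t\<bar> < e / 2"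
    unfolding eventually_at_right_field by (auto simp: dist_real_def)
  have "dist (1 / t * (LINT s:{0<..<t}|lebesgue. \<bar>\<phi> s - d\<bar>)) \<bar>c - d\<bar> < e"
    if t: "0 < t" "t < min \<delta> M" for t
  proof -
    let ?I = "indicator {0<..<t} :: real \<Rightarrow> real"
    define D where "D = (\<lambda>s. ?I s * (\<bar>c + prim w s - d\<bar> - \<bar>c - d\<bar>))"
    have D_bound: "\<bar>D s\<bar> \<le> e / 2 * ?I s" for s
    proof -
      have "\<bar>\<bar>c + prim w s - d\<bar> - \<bar>c - d\<bar>\<bar> \<le> \<bar>prim w s\<bar>"
        by arith
      then show ?thesis
        using \<delta>(2)[of s] t by (cases "s \<in> {0<..<t}") (simp_all add: D_def)
    qed
    have I: "integrable lborel (\<lambda>s. a * ?I s)" for a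
      using t(1) by simp
    have D: "integrable lborel D"
    proof (rule Bochner_Integration.integrable_bound[OF I[of "e / 2"]])
      show "AE s in lborel. norm (D s) \<le> norm (e / 2 * ?I s)"
        using D_bound \<open>e > 0\<close> by (simp add: abs_mult)
    qed (simp add: D_def)
    have "(LINT s:{0<..<t}|lebesgue. \<bar>\<phi> s - d\<bar>) = (\<integral>s. D s + \<bar>c - d\<bar> * ?I s \<partial>lborel)"
      unfolding set_lebesgue_integral_def
    proof (rule integral_lebesgue_AE)
      show "AE s in lebesgue. ?I s *\<^sub>R \<bar>\<phi> s - d\<bar> = D s + \<bar>c - d\<bar> * ?I s"
        using \<phi> by eventually_elim (use t in \<open>auto simp: D_def indicator_def\<close>)
    qed (simp add: D_def)
    also have "\<dots> = (\<integral>s. D s \<partial>lborel) + \<bar>c - d\<bar> * t"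
      using t(1) by (subst Bochner_Integration.integral_add[OF D I]) simp
    finally have "1 / t * (LINT s:{0<..<t}|lebesgue. \<bar>\<phi> s - d\<bar>) - \<bar>c - d\<bar> = (\<integral>s. D s \<partial>lborel) / t"
      using t(1) by (simp add: field_simps)
    moreover have "\<bar>\<integral>s. D s \<partial>lborel\<bar> \<le> e / 2 * t"
    proof -
      have "\<bar>\<integral>s. D s \<partial>lborel\<bar> \<le> (\<integral>s. \<bar>D s\<bar> \<partial>lborel)"
        by (rule integral_abs_bound)
      also have "\<dots> \<le> (\<integral>s. e / 2 * ?I s \<partial>lborel)"
        by (rule integral_mono[OF integrable_abs[OF D] I D_bound])
      also have "\<dots> = e / 2 * t"
        using t(1) by simp
      finally show ?thesis .
    qed
    ultimately have "dist (1 / t * (LINT s:{0<..<t}|lebesgue. \<bar>\<phi> s - d\<bar>)) \<bar>c - d\<bar> \<le> e / 2"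
      using t(1) by (simp add: dist_real_def pos_divide_le_eq)
    then show ?thesis
      using \<open>e > 0\<close> by linarith
  qed
  then show "\<forall>\<^sub>F t in at_right 0. dist (1 / t * (LINT s:{0<..<t}|lebesgue. \<bar>\<phi> s - d\<bar>)) \<bar>c - d\<bar> < e"
    using \<delta>(1) M by (intro eventually_at_rightI[of 0 "min \<delta> M"]) simp_all
qed

lemma right_value_eq:
  assumes w: "integrable lborel w" "\<And>r. r \<le> 0 \<Longrightarrow> w r = 0" and M: "0 < M"
    and \<phi>: "AE t in lebesgue. 0 < t \<and> t < M \<longrightarrow> \<phi> t = c + prim w t"
  shows "right_value \<phi> = c"
  unfolding right_value_def
proof (rule the_equality)
  note lim = average_tendsto_initial_value[OF w M \<phi>]
  show "has_right_value \<phi> c"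
    using lim[of c] by (simp add: has_right_value_def)
  show "d = c" if "has_right_value \<phi> d" for d
    using tendsto_unique[OF _ lim[of d], of 0] that by (auto simp: has_right_value_def)
qed

text \<open>The power is integrable at \<open>0\<close> because \<open>\<gamma> < 1\<close>, but for
  the same reason not at infinity. For \<open>0 < s < t < M\<close> the argument
  \<open>t - s\<close> stays inside the cut, which is therefore invisible.\<close>

definition cut_kernel :: "real \<Rightarrow> real \<Rightarrow> real \<Rightarrow> real" where
  "cut_kernel \<gamma> M x = indicator {0<..M} x * x powr (- \<gamma>)"

lemma integrable_cut_kernel:
  assumes "\<gamma> < 1" "0 < M"
  shows "integrable lborel (cut_kernel \<gamma> M)"
proof -
  have "(\<lambda>x. x powr (- \<gamma>)) absolutely_integrable_on {0<..M}"
    using assms by (intro nonnegative_absolutely_integrable_1 integrable_on_powr_from_0') auto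
  moreover have "cut_kernel \<gamma> M \<in> borel_measurable borel"
    unfolding cut_kernel_def by measurable
  ultimately show ?thesis
    using integrable_completion[of "cut_kernel \<gamma> M" lborel]
    by (simp add: set_integrable_def cut_kernel_def[abs_def])
qed

section \<open>Gluing the local representations and computing the Caputo derivative\<close>

theorem proposition3p6:
  fixes T :: ereal and \<gamma> :: real and \<phi> :: "real \<Rightarrow> real"
  assumes T: "0 < T"
    and \<gamma>: "0 < \<gamma>" "\<gamma> < 1"
    and \<phi>: "\<phi> \<in> X_space T"
    and deriv_integrable: "\<And>T1. 0 < T1 \<Longrightarrow> ereal T1 < T \<Longrightarrow>
      distr_integrable_on {0<..<T1} (distr_deriv (reg_distr {t. 0 < t \<and> ereal t < T} \<phi>))"
  shows "(\<exists>\<psi>.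
      (AE t in lebesgue. 0 < t \<and> ereal t < T \<longrightarrow> \<psi> t = \<phi> t) \<and>
      (\<forall>T1>0. ereal T1 < T \<longrightarrow> abs_cont_on {0<..<T1} \<psi>) \<and>
      (AE t in lebesgue. 0 < t \<and> ereal t < T \<longrightarrow> \<psi> differentiable (at t)) \<and>
      (AE t in lebesgue. 0 < t \<and> ereal t < T \<longrightarrow>
         set_integrable lebesgue {0<..<t} (\<lambda>s. deriv \<psi> s / (t - s) powr \<gamma>)) \<and>
      (let h = (\<lambda>t. 1 / Gamma (1 - \<gamma>) *
                 (LINT s:{0<..<t}|lebesgue. deriv \<psi> s / (t - s) powr \<gamma>))
       in h \<in> L1loc T \<and>
          distr_eq {t. ereal t < T} (caputo_deriv T \<gamma> \<phi>) (L1loc_distr T h))) \<and>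
    (\<exists>h\<in>L1loc T. distr_eq {t. ereal t < T} (caputo_deriv T \<gamma> \<phi>) (L1loc_distr T h))"
proof -
  \<comment> \<open>Fixing the constant before any \<open>M\<close> makes all local representations
    share it.\<close>
  define c where "c = right_value \<phi>"
  let ?P = "\<lambda>M w. integrable lborel w \<and> (\<forall>r. r \<notin> {0<..<M} \<longrightarrow> w r = 0) \<and>
      (AE t in lebesgue. 0 < t \<and> t < M \<longrightarrow> \<phi> t = c + prim w t)"
  have "\<exists>w. ?P M w" if M: "0 < M" "ereal M < T" for M
  proof -
    obtain w d where w: "integrable lborel w" "\<And>r. r \<notin> {0<..<M} \<Longrightarrow> w r = 0"
      "AE t in lebesgue. 0 < t \<and> t < M \<longrightarrow> \<phi> t = d + prim w t"
      using X_space_representation[OF \<phi> M deriv_integrable[OF M]] by blast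
    moreover have "c = d"
      unfolding c_def by (rule right_value_eq[OF w(1) _ M(1) w(3)]) (simp add: w(2))
    ultimately show ?thesis
      by blast
  qed
  then have P: "?P M (SOME w. ?P M w)" if "0 < M" "ereal M < T" for M
    using that by (intro someI_ex[of "?P M"])
  define V where "V M = (SOME w. ?P M w)" for M
  have V: "integrable lborel (V M)" and V_0: "\<And>r. r \<notin> {0<..<M} \<Longrightarrow> V M r = 0"
    and V_\<phi>: "AE t in lebesgue. 0 < t \<and> t < M \<longrightarrow> \<phi> t = c + prim (V M) t" if "0 < M" "ereal M < T" for M
    using P[OF that] unfolding V_def by simp_all
  have consistent: "prim (V M) t = prim (V N) t"
    if M: "0 < M" "ereal M < T" and N: "0 < N" "ereal N < T" and t: "0 < t" "t < M" "t < N" for M N t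
  proof -
    \<comment> \<open>Both sides are continuous and agree almost everywhere where \<open>\<phi>\<close> is represented by both.\<close>
    have "closed ({s. prim (V M) s = prim (V N) s} \<union> {..0} \<union> {min M N..})"
      by (intro closed_Un closed_Collect_eq continuous_prim V M N closed_atMost closed_atLeast)
    moreover have "AE s in lebesgue. s \<in> {s. prim (V M) s = prim (V N) s} \<union> {..0} \<union> {min M N..}"
      using V_\<phi>[OF M] V_\<phi>[OF N] by eventually_elim auto
    ultimately have "t \<in> {s. prim (V M) s = prim (V N) s} \<union> {..0} \<union> {min M N..}"
      by (rule mem_closed_if_AE_lebesgue)
    with t show ?thesis
      by auto
  qed
  \<comment> \<open>No single \<open>V M\<close> is available on all of \<open>(0,T)\<close>, so each point uses an \<open>M\<close> of its own.\<close>
  define m where "m t = (SOME M. t < M \<and> ereal M < T)" for t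
  have m: "t < m t" "ereal (m t) < T" if "ereal t < T" for t
  proof -
    have "\<exists>M. t < M \<and> ereal M < T"
      using ereal_dense2[OF that] by auto
    then have "t < m t \<and> ereal (m t) < T"
      unfolding m_def by (rule someI_ex)
    then show "t < m t" "ereal (m t) < T"
      by auto
  qed
  define \<psi> where "\<psi> t = c + prim (V (m t)) t" for t
  \<comment> \<open>The arbitrary choice in \<open>m\<close> drops out by \<open>consistent\<close>,
    so a single primitive describes \<psi> on all of \<open>(0,M)\<close>.\<close>
  have \<psi>: "\<psi> t = c + prim (V M) t" if M: "0 < M" "ereal M < T" and t: "0 < t" "t < M" for M t
  proof -
    have "ereal t < T"
      using t(2) M(2) by (meson ereal_less_eq(3) le_less_trans less_imp_le)
    then show ?thesis
      using consistent[of "m t" M t] m[of t] M t by (simp add: \<psi>_def)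
  qed
  have \<psi>_deriv: "AE t in lebesgue. 0 < t \<and> t < M \<longrightarrow> (\<psi> has_real_derivative V M t) (at t)"
    if M: "0 < M" "ereal M < T" for M
    using prim_has_derivative_AE[OF V[OF M]]
  proof (eventually_elim, intro impI)
    fix t assume "(prim (V M) has_real_derivative V M t) (at t)" and t: "0 < t \<and> t < M"
    then have "((\<lambda>t. c + prim (V M) t) has_real_derivative 0 + V M t) (at t)"
      by (intro DERIV_add DERIV_const)
    then have "(\<psi> has_real_derivative 0 + V M t) (at t)"
      by (rule has_field_derivative_transform_within_open[OF _ open_greaterThanLessThan[of 0 M]])
         (use t \<psi>[OF M] in auto)
    then show "(\<psi> has_real_derivative V M t) (at t)"
      by simp
  qed
  have kernel: "integrable lborel (cut_kernel \<gamma> M)" if "0 < M" for M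
    by (rule integrable_cut_kernel[OF \<gamma>(2) that])
  \<comment> \<open>Outside \<open>0 < s < t\<close> the right side vanishes by itself:
    \<open>V M\<close> for \<open>s \<le> 0\<close>, the kernel for \<open>s \<ge> t\<close>. Hence
    nonpositive \<open>t\<close> are included.\<close>
  have conv_AE: "AE s in lebesgue. indicator {0<..<t} s *\<^sub>R (deriv \<psi> s / (t - s) powr \<gamma>) = V M s * cut_kernel \<gamma> M (t - s)"
    if M: "0 < M" "ereal M < T" and t: "t < M" for M t
    using \<psi>_deriv[OF M]
  proof eventually_elim
    case (elim s)
    show ?case
    proof (cases "0 < s \<and> s < t")
      case True
      then have "deriv \<psi> s = V M s"
        using elim t by (intro DERIV_imp_deriv) auto
      then show ?thesis
        using True t by (simp add: cut_kernel_def powr_minus_divide)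
    next
      case False
      then have "V M s * cut_kernel \<gamma> M (t - s) = 0"
        using V_0[OF M, of s] by (auto simp: cut_kernel_def)
      then show ?thesis
        using False by auto
    qed
  qed
  define h where "h = (\<lambda>t. 1 / Gamma (1 - \<gamma>) * (LINT s:{0<..<t}|lebesgue. deriv \<psi> s / (t - s) powr \<gamma>))"
  define H where "H M t = 1 / Gamma (1 - \<gamma>) * (\<integral>s. V M s * cut_kernel \<gamma> M (t - s) \<partial>lborel)" for M t
  have conv_meas: "(\<lambda>s. V M s * cut_kernel \<gamma> M (t - s)) \<in> borel_measurable borel" if M: "0 < M" "ereal M < T" for M t
    using borel_measurable_integrable[OF V[OF M]] borel_measurable_integrable[OF kernel[OF M(1)]] by measurable
  \<comment> \<open>This holds for every \<open>t < M\<close>, including those where the integrals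
    do not converge: both are then given the same default value.\<close>
  have h: "h t = H M t" if M: "0 < M" "ereal M < T" and t: "t < M" for M t
    unfolding h_def H_def set_lebesgue_integral_def
    by (simp only: integral_lebesgue_AE[OF conv_AE[OF M t] conv_meas[OF M]])
  have H: "integrable lborel (H M)" if M: "0 < M" "ereal M < T" for M
    unfolding H_def by (intro integrable_mult_right integrable_convolution V kernel M)
  have h_L1loc: "h \<in> L1loc T"
    unfolding L1loc_def
  proof (clarify)
    fix K :: "real set" assume K: "compact K" "K \<subseteq> {t. 0 \<le> t \<and> ereal t < T}"
    then obtain M where M: "0 < M" "ereal M < T" "K \<subseteq> {..<M}"
      using compact_below_ereal[of K T] T by blast
    have [measurable]: "K \<in> sets borel"
      using K(1) by (rule borel_compact)
    have HK: "integrable lborel (\<lambda>t. indicator K t * H M t)"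
      using integrable_mult_indicator[OF _ H[OF M(1,2)], of K] by simp
    have "AE t in lebesgue. indicator K t *\<^sub>R h t = indicator K t * H M t"
      using h[OF M(1,2)] M(3) by (intro AE_I2) (auto simp: indicator_def)
    from integrable_lebesgue_AE[OF this] borel_measurable_integrable[OF HK] HK
    show "set_integrable lebesgue K h"
      by (simp add: set_integrable_def)
  qed
  have h_distr: "distr_eq {t. ereal t < T} (caputo_deriv T \<gamma> \<phi>) (L1loc_distr T h)"
    unfolding distr_eq_def
  proof
    fix f assume f: "f \<in> test_fun {t. ereal t < T}"
    let ?U = "{t. ereal t < T}" and ?G = "1 / Gamma (1 - \<gamma>)"
    obtain K where K: "compact K" "K \<subseteq> ?U" "\<And>x. x \<notin> K \<Longrightarrow> f x = 0" "\<And>x. x \<notin> K \<Longrightarrow> deriv f x = 0"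
      using f by (rule test_funE) blast
    obtain M where M: "0 < M" "ereal M < T" "K \<subseteq> {..<M}"
      using compact_below_ereal[OF K(1,2) T] by blast
    note sm = test_fun_smooth[OF f]
    note meas = smooth_borel_measurable[OF sm] smooth_borel_measurable[OF smooth_deriv[OF sm]]
    define k where "k = cut_kernel \<gamma> M"
    define F where "F = (\<lambda>s. indicator {0<..<M} s * (c + prim (V M) s))"
    have k: "integrable lborel k" "\<And>x. x \<le> 0 \<Longrightarrow> k x = 0"
      using kernel[OF M(1)] by (auto simp: k_def cut_kernel_def)
    have V0: "V M r = 0" if "r \<le> 0" for r
      using V_0[OF M(1,2), of r] that by simp
    have "integrable lborel (\<lambda>s. c * indicator {0<..<M} s + prim (V M) s * indicator {0<..<M} s)"
      using M(1) by (intro Bochner_Integration.integrable_add integrable_mult_right integrable_prim_mult V M(2)) simp_all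
    then have F: "integrable lborel F"
      by (simp add: F_def algebra_simps)
    note [measurable] = borel_measurable_integrable[OF F] borel_measurable_integrable[OF k(1)]
    \<comment> \<open>Together with \<open>V_conv\<close> this makes the factor
      \<open>heaviside\<close> in \<open>L1loc_distr\<close> harmless: the convolutions already
      vanish for \<open>t \<le> 0\<close>.\<close>
    have F_conv: "(\<integral>s. F s * k (t - s) \<partial>lborel) = 0" if "t \<le> 0" for t
    proof -
      have "F s * k (t - s) = 0" for s
        using that k(2)[of "t - s"] by (cases "s \<le> 0") (auto simp: F_def)
      then show ?thesis
        by (simp only:) simp
    qed
    have V_conv: "H M t = 0" if "t \<le> 0" for t
    proof -
      have "V M s * k (t - s) = 0" for s
        using that k(2)[of "t - s"] V0[of s] by (cases "s \<le> 0") auto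
      then show ?thesis
        unfolding H_def k_def by (simp only:) simp
    qed
    have \<phi>_conv: "(LINT s:{0<..<t}|lebesgue. (t - s) powr (- \<gamma>) * \<phi> s) = (\<integral>s. F s * k (t - s) \<partial>lborel)"
      if t: "t < M" for t
      unfolding set_lebesgue_integral_def
    proof (rule integral_lebesgue_AE)
      show "AE s in lebesgue. indicator {0<..<t} s *\<^sub>R ((t - s) powr (- \<gamma>) * \<phi> s) = F s * k (t - s)"
        using V_\<phi>[OF M(1,2)]
        by eventually_elim (use t in \<open>auto simp: F_def k_def cut_kernel_def indicator_def\<close>)
    qed measurable
    have "L1loc_distr T (\<lambda>t. ?G * (LINT s:{0<..<t}|lebesgue. (t - s) powr (- \<gamma>) * \<phi> s)) (deriv f) =
        (\<integral>t. (?G * (\<integral>s. F s * k (t - s) \<partial>lborel)) * deriv f t \<partial>lborel)"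
      unfolding L1loc_distr_def
    proof (rule reg_distr_eq_integral[OF K(2,4) meas(2)])
      show "(\<lambda>t. ?G * (\<integral>s. F s * k (t - s) \<partial>lborel)) \<in> borel_measurable borel"
        using borel_measurable_integrable[OF integrable_convolution[OF F k(1)]] by measurable
      show "AE t in lebesgue. t \<in> K \<longrightarrow> heaviside t * (?G * (LINT s:{0<..<t}|lebesgue. (t - s) powr (- \<gamma>) * \<phi> s)) =
          ?G * (\<integral>s. F s * k (t - s) \<partial>lborel)"
        using \<phi>_conv F_conv M(3) by (intro AE_I2) (auto simp: heaviside_def)
    qed
    also have "\<dots> = ?G * (\<integral>t. (\<integral>s. F s * k (t - s) \<partial>lborel) * deriv f t \<partial>lborel)"
      by (simp only: mult.assoc integral_mult_right_zero)
    also have "(\<integral>t. (\<integral>s. F s * k (t - s) \<partial>lborel) * deriv f t \<partial>lborel) =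
        - c * (\<integral>t. k t * f t \<partial>lborel) - (\<integral>t. (\<integral>s. V M s * k (t - s) \<partial>lborel) * f t \<partial>lborel)"
      unfolding F_def by (rule convolution_prim_mult_deriv[OF k V[OF M(1,2)] V0 sm K(1,3,4) M(3)])
    finally have J: "J_neg T \<gamma> \<phi> f = ?G * (c * (\<integral>t. k t * f t \<partial>lborel) + (\<integral>t. (\<integral>s. V M s * k (t - s) \<partial>lborel) * f t \<partial>lborel))"
      by (simp add: J_neg_def distr_deriv_def algebra_simps)
    have "reg_distr ?U (g_kernel (1 - \<gamma>)) f = (\<integral>t. (?G * k t) * f t \<partial>lborel)"
    proof (rule reg_distr_eq_integral[OF K(2,3) meas(1)])
      \<comment> \<open>The sides agree even at \<open>t = 0\<close>, where \<open>heaviside\<close>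
        is \<open>1\<close> but \<open>0 powr (- \<gamma>)\<close> is \<open>0\<close>.\<close>
      show "AE t in lebesgue. t \<in> K \<longrightarrow> g_kernel (1 - \<gamma>) t = ?G * k t"
        using M(3) by (intro AE_I2) (auto simp: g_kernel_def heaviside_def k_def cut_kernel_def indicator_def)
    qed measurable
    then have g: "reg_distr ?U (g_kernel (1 - \<gamma>)) f = ?G * (\<integral>t. k t * f t \<partial>lborel)"
      by (simp only: mult.assoc integral_mult_right_zero)
    have "L1loc_distr T h f = (\<integral>t. H M t * f t \<partial>lborel)"
      unfolding L1loc_distr_def
    proof (rule reg_distr_eq_integral[OF K(2,3) meas(1)])
      show "H M \<in> borel_measurable borel"
        using borel_measurable_integrable[OF H[OF M(1,2)]] by simp
      show "AE t in lebesgue. t \<in> K \<longrightarrow> heaviside t * h t = H M t"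
        using h[OF M(1,2)] V_conv M(3) by (intro AE_I2) (auto simp: heaviside_def)
    qed
    also have "\<dots> = ?G * (\<integral>t. (\<integral>s. V M s * k (t - s) \<partial>lborel) * f t \<partial>lborel)"
      unfolding H_def k_def by (simp only: mult.assoc integral_mult_right_zero)
    finally show "caputo_deriv T \<gamma> \<phi> f = L1loc_distr T h f"
      by (simp add: caputo_deriv_def J g c_def[symmetric] algebra_simps)
  qed
  have "AE t in lebesgue. 0 < t \<and> ereal t < T \<longrightarrow> \<psi> t = \<phi> t"
  proof (rule AE_below_ereal)
    fix M assume M: "0 < M" "ereal M < T"
    show "AE t in lebesgue. 0 < t \<and> t < M \<longrightarrow> \<psi> t = \<phi> t"
      using V_\<phi>[OF M] by eventually_elim (use \<psi>[OF M] in auto)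
  qed
  moreover have "\<forall>T1>0. ereal T1 < T \<longrightarrow> abs_cont_on {0<..<T1} \<psi>"
  proof (intro allI impI)
    fix M :: real assume M: "0 < M" "ereal M < T"
    show "abs_cont_on {0<..<M} \<psi>"
      by (rule abs_cont_on_prim[OF V[OF M]]) (use \<psi>[OF M] in auto)
  qed
  moreover have "AE t in lebesgue. 0 < t \<and> ereal t < T \<longrightarrow> \<psi> differentiable (at t)"
  proof (rule AE_below_ereal)
    fix M assume M: "0 < M" "ereal M < T"
    show "AE t in lebesgue. 0 < t \<and> t < M \<longrightarrow> \<psi> differentiable (at t)"
      using \<psi>_deriv[OF M] by eventually_elim (auto simp: real_differentiable_def)
  qed
  moreover have "AE t in lebesgue. 0 < t \<and> ereal t < T \<longrightarrow>
      set_integrable lebesgue {0<..<t} (\<lambda>s. deriv \<psi> s / (t - s) powr \<gamma>)"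
  proof (rule AE_below_ereal)
    fix M assume M: "0 < M" "ereal M < T"
    \<comment> \<open>Fubini gives convergence of the convolution of two integrable functions for
      almost every \<open>t\<close>, whence the form of this claim.\<close>
    have "AE t in lebesgue. integrable lborel (\<lambda>s. V M s * cut_kernel \<gamma> M (t - s))"
      by (intro AE_completion AE_integrable_convolution V kernel M)
    then show "AE t in lebesgue. 0 < t \<and> t < M \<longrightarrow>
        set_integrable lebesgue {0<..<t} (\<lambda>s. deriv \<psi> s / (t - s) powr \<gamma>)"
      by eventually_elim
        (use integrable_lebesgue_AE[OF conv_AE[OF M] conv_meas[OF M]] in \<open>auto simp: set_integrable_def\<close>)
  qed
  ultimately show ?thesis
    using h_L1loc h_distr unfolding Let_def h_def by blast
qed

end
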